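(* Let $\delta < \epsilon$ and let $\mathcal{S} = \{\mathcal{Q}_1, \mathcal{Q}_2, \ldots\}$ be a collection of quantum systems such that the output distribution of every $\mathcal{Q}_i \in \mathcal{S}$ is either $\mu_\delta$ or $\mu_\epsilon$. Then there is a $\mathcal{B}$-transform $\mathcal{B}_{\delta,\epsilon}$ that perfectly solves $\mathcal{S}$, i.e., every $\mathcal{Q}_i\in\mathcal{S}$ is transformed by $\mathcal{B}_{\delta,\epsilon}$ into a quantum system $\mathcal{Q}'_i$ such that: if the output distribution of $\mathcal{Q}_i$ is $\mu_\delta$ then the outcome of $\mathcal{Q}'_i$ is never $E$, and if the output distribution of $\mathcal{Q}_i$ is $\mu_\epsilon$ then the outcome of $\mathcal{Q}'_i$ is always $E$.
   Context: A quantum system (QS) is a triple $\langle \ket{\psi}, C, \mathcal{P}\rangle$ of an input state $\ket{\psi}$, a quantum circuit $C$ (unitary), and a two-outcome projective measurement $\mathcal{P}=\langle P_E, I-P_E\rangle$ with outcomes labeled $E$ and $F$. Its output distribution is $\langle p, 1-p\rangle$ where $p=\|P_E C\ket{\psi}\|^2$ is the probability of outcome $E$; the "outcome" of the QS is the result of this measurement. $\mu_p$ denotes the distribution $\langle p, 1-p\rangle$ over $\langle E,F\rangle$. A $\mathcal{B}$-transform (parametrized by $\delta,\epsilon$) is a procedure mapping each QS $\mathcal{Q}_1=\langle\ket{\psi},C,\mathcal{P}\rangle$ to a QS $\mathcal{Q}_2=\langle \ket{\psi}\otimes\ket{0\cdots0}, C', \mathcal{P}\otimes\mathcal{P}_a\rangle$,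 where the number of ancilla qubits and the two-outcome projective measurement $\mathcal{P}_a$ on them are independent of $\mathcal{Q}_1$ and depend only on $\delta,\epsilon$, and the circuit $C'$ calls $C$ and $C^\dagger$ and otherwise uses gates that depend on $\delta,\epsilon$ and possibly on $P_E$ and $\ket{\psi}$. (The outcome-$E$ projector of $\mathcal{P}\otimes\mathcal{P}_a$ is the tensor product of the outcome-$E$ projectors.) *)

theory Defs
  imports Complex_Main "Jordan_Normal_Form.Schur_Decomposition"
begin

definition sq_norm2 :: "complex vec \<Rightarrow> real" where
  "sq_norm2 v = (\<Sum>i<dim_vec v. (cmod (v $ i))\<^sup>2)"

definition unitary_mat :: "nat \<Rightarrow> complex mat \<Rightarrow> bool" where
  "unitary_mat d U \<longleftrightarrow> U \<in> carrier_mat d d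
     \<and> U * mat_adjoint U = 1\<^sub>m d \<and> mat_adjoint U * U = 1\<^sub>m d"

definition projector_mat :: "nat \<Rightarrow> complex mat \<Rightarrow> bool" where
  "projector_mat d P \<longleftrightarrow> P \<in> carrier_mat d d \<and> mat_adjoint P = P \<and> P * P = P"

definition state_vec :: "nat \<Rightarrow> complex vec \<Rightarrow> bool" where
  "state_vec d v \<longleftrightarrow> v \<in> carrier_vec d \<and> sq_norm2 v = 1"

text \<open>Kronecker products; the basis vector \<open>|a\<rangle> \<otimes> |b\<rangle>\<close> has index \<open>a * n + b\<close>, where \<open>n\<close> is the
  dimension of the second factor.\<close>

definition tensor_vec :: "complex vec \<Rightarrow> complex vec \<Rightarrow> complex vec" where
  "tensor_vec u v = vec (dim_vec u * dim_vec v)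
     (\<lambda>i. u $ (i div dim_vec v) * v $ (i mod dim_vec v))"

definition tensor_mat :: "complex mat \<Rightarrow> complex mat \<Rightarrow> complex mat" where
  "tensor_mat A B = mat (dim_row A * dim_row B) (dim_col A * dim_col B)
     (\<lambda>(i, j). A $$ (i div dim_row B, j div dim_col B) * B $$ (i mod dim_row B, j mod dim_col B))"

text \<open>The measurement \<open>\<langle>P\<^sub>E, I - P\<^sub>E\<rangle>\<close> of a quantum system is represented by its outcome-\<open>E\<close> projector.
  The dimension of the system is that of its input state, so that one collection may contain
  systems of different dimensions; \<open>n\<close> qubits correspond to dimension \<open>2 ^ n\<close>.\<close>

datatype qsys = QSys (input: "complex vec") (circuit: "complex mat") (proj_E: "complex mat")

definition quantum_system :: "qsys \<Rightarrow> bool" where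
  "quantum_system Q \<longleftrightarrow> (let d = dim_vec (input Q) in
     state_vec d (input Q) \<and> unitary_mat d (circuit Q) \<and> projector_mat d (proj_E Q))"

definition prob_E :: "qsys \<Rightarrow> real" where
  "prob_E Q = sq_norm2 (proj_E Q *\<^sub>v (circuit Q *\<^sub>v input Q))"

definition output_dist :: "qsys \<Rightarrow> real \<times> real" where
  "output_dist Q = (prob_E Q, 1 - prob_E Q)"

definition mu :: "real \<Rightarrow> real \<times> real" where
  "mu p = (p, 1 - p)"

text \<open>A step of the transformed circuit is a call to \<open>C\<close>, a call to its adjoint, or a gate, which is
  a function of \<open>P\<^sub>E\<close> and \<open>|\<psi>\<rangle>\<close> but not of \<open>C\<close>. The sequence of steps, the number of ancilla qubits
  and the outcome-\<open>E\<close> projector on the ancillas are fixed for all quantum systems.\<close>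

datatype step = Call_C | Call_C_adj | Gate "complex mat \<Rightarrow> complex vec \<Rightarrow> complex mat"

datatype transform =
  Transform (ancillas: nat) (ancilla_proj: "complex mat") (steps: "step list")

definition B_transform :: "transform \<Rightarrow> bool" where
  "B_transform B \<longleftrightarrow> projector_mat (2 ^ ancillas B) (ancilla_proj B)
     \<and> (\<forall>g. Gate g \<in> set (steps B) \<longrightarrow>
          (\<forall>d P \<psi>. projector_mat d P \<longrightarrow> state_vec d \<psi> \<longrightarrow>
             unitary_mat (d * 2 ^ ancillas B) (g P \<psi>)))"

fun step_mat :: "nat \<Rightarrow> qsys \<Rightarrow> step \<Rightarrow> complex mat" where
  "step_mat k Q Call_C = tensor_mat (circuit Q) (1\<^sub>m (2 ^ k))"
| "step_mat k Q Call_C_adj = tensor_mat (mat_adjoint (circuit Q)) (1\<^sub>m (2 ^ k))"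
| "step_mat k Q (Gate g) = g (proj_E Q) (input Q)"

text \<open>The head of the list is executed first.\<close>

fun steps_mat :: "nat \<Rightarrow> qsys \<Rightarrow> step list \<Rightarrow> complex mat" where
  "steps_mat k Q [] = 1\<^sub>m (dim_vec (input Q) * 2 ^ k)"
| "steps_mat k Q (s # ss) = steps_mat k Q ss * step_mat k Q s"

definition apply_transform :: "transform \<Rightarrow> qsys \<Rightarrow> qsys" where
  "apply_transform B Q =
     QSys (tensor_vec (input Q) (unit_vec (2 ^ ancillas B) 0))
          (steps_mat (ancillas B) Q (steps B))
          (tensor_mat (proj_E Q) (ancilla_proj B))"

definition perfectly_solves :: "transform \<Rightarrow> real \<Rightarrow> real \<Rightarrow> qsys set \<Rightarrow> bool" where
  "perfectly_solves B \<delta> \<epsilon> S \<longleftrightarrow> (\<forall>Q\<in>S.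
     quantum_system (apply_transform B Q)
     \<and> (output_dist Q = mu \<delta> \<longrightarrow> prob_E (apply_transform B Q) = 0)
     \<and> (output_dist Q = mu \<epsilon> \<longrightarrow> prob_E (apply_transform B Q) = 1))"

end

theory Submission
  imports Defs
begin

text \<open>
  With one ancilla qubit and two \<open>2 \<times> 2\<close> reflections \<open>A\<close>, \<open>B\<close> having upper left entries \<open>a\<close>, \<open>b\<close>, the
  reflection \<open>V = (C\<^sup>\<dagger> \<otimes> I) (P\<^sub>E \<otimes> A + (I - P\<^sub>E) \<otimes> B) (C \<otimes> I)\<close> satisfies
  \<open>\<langle>e, V e\<rangle> = p a + (1 - p) b\<close> for \<open>e = |\<psi>\<rangle> \<otimes> |0\<rangle>\<close>. Choose \<open>a\<close> and \<open>b\<close> so that this overlap is \<open>0\<close> for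
  \<open>p = \<delta>\<close> and \<open>sin (\<pi> / 2n)\<close> for \<open>p = \<epsilon>\<close>, where \<open>n = 2 l + 1\<close> is large enough for \<open>a, b \<in> [-1, 1]\<close>.
  Alternating \<open>V\<close> with the reflection along \<open>e\<close> is a rotation of the plane spanned by \<open>e\<close> and \<open>V e\<close>;
  after \<open>n\<close> uses of \<open>V\<close> the overlap with \<open>e\<close> is, up to sign, the Chebyshev polynomial \<open>T\<^sub>n\<close> of the
  initial overlap. As \<open>T\<^sub>n\<close> is odd and \<open>|T\<^sub>n (sin (\<pi> / 2n))| = 1\<close>, the state is orthogonal to \<open>e\<close> if
  \<open>p = \<delta>\<close> and equals \<open>\<plusminus>e\<close> if \<open>p = \<epsilon>\<close>. A last reflection exchanges \<open>e\<close> with a state in the range of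
  \<open>P\<^sub>E \<otimes> |2\<rangle>\<langle>2|\<close>, where \<open>|2\<rangle>\<close> is an ancilla level untouched so far.
\<close>

subsection \<open>Adjoints, unitaries and reflections\<close>

lemma unitary_matI:
  assumes "U \<in> carrier_mat n n" "U * mat_adjoint U = 1\<^sub>m n" "mat_adjoint U * U = 1\<^sub>m n"
  shows "unitary_mat n U"
  using assms by (simp add: unitary_mat_def)

lemma mat_adjoint_dim [simp]:
  "dim_row (mat_adjoint A) = dim_col A" "dim_col (mat_adjoint A) = dim_row A"
  by (simp_all add: mat_adjoint_def)

lemma mat_adjoint_carrier [simp]:
  "A \<in> carrier_mat m n \<Longrightarrow> mat_adjoint A \<in> carrier_mat n m"
  by (auto intro!: carrier_matI)

lemma mat_adjoint_index [simp]:
  fixes A :: "complex mat"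
  shows "i < dim_col A \<Longrightarrow> j < dim_row A \<Longrightarrow> mat_adjoint A $$ (i, j) = cnj (A $$ (j, i))"
  by (simp add: mat_adjoint_def mat_of_rows_index)

lemma mat_adjoint_adjoint [simp]:
  fixes A :: "complex mat"
  shows "mat_adjoint (mat_adjoint A) = A"
  by (rule eq_matI) simp_all

lemma mat_adjoint_one [simp]: "mat_adjoint (1\<^sub>m n :: complex mat) = 1\<^sub>m n"
  by (rule eq_matI) auto

lemma mat_adjoint_add:
  fixes A B :: "complex mat"
  assumes "A \<in> carrier_mat m n" "B \<in> carrier_mat m n"
  shows "mat_adjoint (A + B) = mat_adjoint A + mat_adjoint B"
  using assms by (intro eq_matI) auto

lemma mat_adjoint_minus:
  fixes A B :: "complex mat"
  assumes "A \<in> carrier_mat m n" "B \<in> carrier_mat m n"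
  shows "mat_adjoint (A - B) = mat_adjoint A - mat_adjoint B"
  using assms by (intro eq_matI) auto

lemma mat_adjoint_mult:
  fixes A B :: "complex mat"
  assumes "A \<in> carrier_mat m n" "B \<in> carrier_mat n k"
  shows "mat_adjoint (A * B) = mat_adjoint B * mat_adjoint A"
  using assms by (intro eq_matI) (auto simp: scalar_prod_def intro!: sum.cong)

lemma cscalar_prod_sum:
  fixes u v :: "complex vec"
  shows "u \<bullet>c v = (\<Sum>i<dim_vec v. u $ i * cnj (v $ i))"
  by (auto simp: scalar_prod_def lessThan_atLeast0 intro!: sum.cong)

lemma mult_mat_vec_sum:
  fixes A :: "complex mat"
  assumes "i < dim_row A" "dim_vec v = dim_col A"
  shows "(A *\<^sub>v v) $ i = (\<Sum>j<dim_col A. A $$ (i, j) * v $ j)"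
  using assms by (auto simp: scalar_prod_def lessThan_atLeast0 intro!: sum.cong)

lemma cscalar_prod_mult_mat_vec:
  fixes A :: "complex mat"
  assumes "A \<in> carrier_mat m n" "u \<in> carrier_vec n" "v \<in> carrier_vec m"
  shows "(A *\<^sub>v u) \<bullet>c v = u \<bullet>c (mat_adjoint A *\<^sub>v v)"
proof -
  have "(A *\<^sub>v u) \<bullet>c v = (\<Sum>i<m. \<Sum>j<n. A $$ (i, j) * u $ j * cnj (v $ i))"
    using assms by (simp add: cscalar_prod_sum mult_mat_vec_sum sum_distrib_right
        del: index_mult_mat_vec)
  also have "\<dots> = (\<Sum>j<n. \<Sum>i<m. A $$ (i, j) * u $ j * cnj (v $ i))"
    by (rule sum.swap)
  also have "\<dots> = u \<bullet>c (mat_adjoint A *\<^sub>v v)"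
    using assms by (simp add: cscalar_prod_sum mult_mat_vec_sum sum_distrib_left mult_ac
        del: index_mult_mat_vec)
  finally show ?thesis .
qed

lemma sq_norm2_cscalar_prod: "complex_of_real (sq_norm2 v) = v \<bullet>c v"
  by (simp only: sq_norm2_def cscalar_prod_sum complex_norm_square[symmetric] of_real_sum)

text \<open>Column \<open>j\<close> of a matrix is its value at the unit vector \<open>j\<close>.
  This allows matrix identities about reflections to be checked on vectors.\<close>

lemma mat_eqI_mult_vec:
  fixes A B :: "complex mat"
  assumes A: "A \<in> carrier_mat m n" and B: "B \<in> carrier_mat m n"
    and eq: "\<And>v. v \<in> carrier_vec n \<Longrightarrow> A *\<^sub>v v = B *\<^sub>v v"
  shows "A = B"
proof (rule eq_matI)
  fix i j assume "i < dim_row B" "j < dim_col B"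
  then have ij: "i < m" "j < n" using B by auto
  have "(A *\<^sub>v unit_vec n j) $ i = (B *\<^sub>v unit_vec n j) $ i"
    by (simp add: eq)
  with ij A B show "A $$ (i, j) = B $$ (i, j)"
    by simp
qed (use A B in auto)

section \<open>Closure properties of unitary matrices and Householder reflections\<close>

lemma unitary_mat_one: "unitary_mat n (1\<^sub>m n)"
  by (simp add: unitary_mat_def)

lemma unitary_mat_adjoint: "unitary_mat n U \<Longrightarrow> unitary_mat n (mat_adjoint U)"
  by (simp add: unitary_mat_def)

lemma unitary_mat_mult:
  assumes "unitary_mat n U" "unitary_mat n V"
  shows "unitary_mat n (U * V)"
proof (rule unitary_matI)
  have [simp]: "U \<in> carrier_mat n n" "V \<in> carrier_mat n n"
    and U: "U * mat_adjoint U = 1\<^sub>m n" "mat_adjoint U * U = 1\<^sub>m n"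
    and V: "V * mat_adjoint V = 1\<^sub>m n" "mat_adjoint V * V = 1\<^sub>m n"
    using assms by (auto simp: unitary_mat_def)
  have adj: "mat_adjoint (U * V) = mat_adjoint V * mat_adjoint U"
    by (rule mat_adjoint_mult[of _ n n _ n]) auto
  show "U * V \<in> carrier_mat n n" using mult_carrier_mat[of U n n V n] by simp
  have "U * V * mat_adjoint (U * V) = U * (V * (mat_adjoint V * mat_adjoint U))"
    unfolding adj by (rule assoc_mult_mat[of _ n n _ n _ n]) (auto intro!: mult_carrier_mat[of _ n n _ n])
  also have "V * (mat_adjoint V * mat_adjoint U) = V * mat_adjoint V * mat_adjoint U"
    by (rule assoc_mult_mat[symmetric, of _ n n _ n _ n]) (auto intro!: mult_carrier_mat[of _ n n _ n])
  finally show "U * V * mat_adjoint (U * V) = 1\<^sub>m n"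
    by (simp add: U V left_mult_one_mat[of _ n n])
  have "mat_adjoint (U * V) * (U * V) = mat_adjoint V * (mat_adjoint U * (U * V))"
    unfolding adj by (rule assoc_mult_mat[of _ n n _ n _ n]) (auto intro!: mult_carrier_mat[of _ n n _ n])
  also have "mat_adjoint U * (U * V) = mat_adjoint U * U * V"
    by (rule assoc_mult_mat[symmetric, of _ n n _ n _ n]) (auto intro!: mult_carrier_mat[of _ n n _ n])
  finally show "mat_adjoint (U * V) * (U * V) = 1\<^sub>m n"
    by (simp add: U V left_mult_one_mat[of _ n n])
qed

text \<open>The matrix of \<open>I - 2 |w><w|\<close>. For a unit vector \<open>w\<close> it negates
  \<open>w\<close> and fixes the orthogonal complement; normalisation is not built in, so
  \<open>state_vec\<close> is assumed where the reflection property matters.\<close>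

definition householder :: "complex vec \<Rightarrow> complex mat" where
  "householder w = mat (dim_vec w) (dim_vec w)
     (\<lambda>(i, j). (if i = j then 1 else 0) - 2 * w $ i * cnj (w $ j))"

lemma householder_carrier [simp]:
  "w \<in> carrier_vec n \<Longrightarrow> householder w \<in> carrier_mat n n"
  by (simp add: householder_def)

lemma householder_mult_vec:
  assumes "w \<in> carrier_vec n" "v \<in> carrier_vec n"
  shows "householder w *\<^sub>v v = v - (2 * (v \<bullet>c w)) \<cdot>\<^sub>v w"
proof (rule eq_vecI)
  fix i assume "i < dim_vec (v - (2 * (v \<bullet>c w)) \<cdot>\<^sub>v w)"
  then have i: "i < n" using assms by auto
  have "(householder w *\<^sub>v v) $ i
      = (\<Sum>j<n. ((if i = j then 1 else 0) - 2 * w $ i * cnj (w $ j)) * v $ j)"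
    using assms i by (subst mult_mat_vec_sum) (auto simp: householder_def intro!: sum.cong)
  also have "\<dots> = (\<Sum>j<n. if i = j then v $ j else 0) - 2 * w $ i * (\<Sum>j<n. v $ j * cnj (w $ j))"
    unfolding sum_distrib_left sum_subtractf[symmetric]
    by (rule sum.cong) (auto simp: algebra_simps)
  finally show "(householder w *\<^sub>v v) $ i = (v - (2 * (v \<bullet>c w)) \<cdot>\<^sub>v w) $ i"
    using assms i by (simp add: cscalar_prod_sum del: index_mult_mat_vec)
qed (use assms in \<open>auto simp: householder_def\<close>)

lemma householder_adjoint: "mat_adjoint (householder w) = householder w"
  by (rule eq_matI) (auto simp: householder_def)

lemma cscalar_prod_minus_left:
  fixes u v w :: "complex vec"
  assumes "u \<in> carrier_vec n" "v \<in> carrier_vec n" "w \<in> carrier_vec n"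
  shows "(u - v) \<bullet>c w = u \<bullet>c w - v \<bullet>c w"
  using assms by (simp add: cscalar_prod_sum left_diff_distrib sum_subtractf)

lemma cscalar_prod_add_left:
  fixes u v w :: "complex vec"
  assumes "u \<in> carrier_vec n" "v \<in> carrier_vec n" "w \<in> carrier_vec n"
  shows "(u + v) \<bullet>c w = u \<bullet>c w + v \<bullet>c w"
  using assms by (simp add: cscalar_prod_sum distrib_right sum.distrib)

lemma cscalar_prod_smult_left:
  fixes u w :: "complex vec"
  assumes "u \<in> carrier_vec n" "w \<in> carrier_vec n"
  shows "(c \<cdot>\<^sub>v u) \<bullet>c w = c * (u \<bullet>c w)"
  using assms by (simp add: cscalar_prod_sum sum_distrib_left mult_ac)

lemma cscalar_prod_commute:
  fixes u w :: "complex vec"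
  assumes "u \<in> carrier_vec n" "w \<in> carrier_vec n"
  shows "u \<bullet>c w = cnj (w \<bullet>c u)"
  using assms by (simp add: cscalar_prod_sum mult_ac)

text \<open>The reflection reverses the sign of the component along \<open>w\<close>, so the second
  application adds back what the first one subtracted.\<close>

lemma householder_square:
  assumes "state_vec n w"
  shows "householder w * householder w = 1\<^sub>m n"
proof (rule mat_eqI_mult_vec[where m = n and n = n])
  have w: "w \<in> carrier_vec n" and ww: "w \<bullet>c w = 1"
    using assms by (simp_all add: state_vec_def flip: sq_norm2_cscalar_prod)
  note H = householder_carrier[OF w]
  show "householder w * householder w \<in> carrier_mat n n"
    using H H by (rule mult_carrier_mat)
  fix v :: "complex vec" assume v: "v \<in> carrier_vec n"
  let ?u = "v - (2 * (v \<bullet>c w)) \<cdot>\<^sub>v w"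
  have u: "?u \<in> carrier_vec n" using v w by simp
  have "?u \<bullet>c w = v \<bullet>c w - 2 * (v \<bullet>c w)"
    using v w ww by (simp add: cscalar_prod_minus_left[of _ n] cscalar_prod_smult_left[of _ n])
  then have uw: "?u \<bullet>c w = - (v \<bullet>c w)" by simp
  have "householder w * householder w *\<^sub>v v = householder w *\<^sub>v ?u"
    using H v by (simp add: assoc_mult_mat_vec[of _ n n _ n] householder_mult_vec[OF w v])
  also have "\<dots> = ?u - (2 * - (v \<bullet>c w)) \<cdot>\<^sub>v w"
    using householder_mult_vec[OF w u] by (simp add: uw)
  also have "\<dots> = v" using v w by (intro eq_vecI) auto
  finally show "householder w * householder w *\<^sub>v v = 1\<^sub>m n *\<^sub>v v" using v by simp
qed simp

lemma householder_unitary: "state_vec n w \<Longrightarrow> unitary_mat n (householder w)"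
  by (auto intro!: unitary_matI simp: householder_adjoint householder_square state_vec_def)

subsection \<open>Tensor products\<close>

lemma tensor_vec_carrier [simp]:
  "u \<in> carrier_vec m \<Longrightarrow> v \<in> carrier_vec n \<Longrightarrow> tensor_vec u v \<in> carrier_vec (m * n)"
  by (auto simp: tensor_vec_def)

lemma tensor_mat_carrier [simp]:
  "A \<in> carrier_mat m n \<Longrightarrow> B \<in> carrier_mat k l \<Longrightarrow> tensor_mat A B \<in> carrier_mat (m * k) (n * l)"
  by (auto simp: tensor_mat_def)

lemma div_mod_less_mult:
  fixes i :: nat
  assumes "i < m * n"
  shows "i div n < m" "i mod n < n"
proof -
  show "i div n < m" using assms by (simp add: less_mult_imp_div_less)
  show "i mod n < n" using assms by (cases n) auto
qed

text \<open>Quotient and remainder modulo \<open>n\<close> identify the indices below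
  \<open>m * n\<close> with pairs. Sums over a Kronecker index thereby become double sums, which is
  what the product rules for tensors rest on.\<close>

lemma sum_lessThan_mult_div_mod:
  fixes f :: "nat \<Rightarrow> nat \<Rightarrow> 'a :: comm_monoid_add"
  shows "(\<Sum>k<m * n. f (k div n) (k mod n)) = (\<Sum>i<m. \<Sum>j<n. f i j)"
proof -
  have bound: "i * n + j < m * n" if "i < m" "j < n" for i j
  proof -
    have "i * n + j < Suc i * n" using that by simp
    also have "\<dots> \<le> m * n" using that by (intro mult_le_mono1) simp
    finally show ?thesis .
  qed
  have "(\<Sum>i<m. \<Sum>j<n. f i j) = (\<Sum>(i, j)\<in>{..<m} \<times> {..<n}. f i j)"
    by (rule sum.cartesian_product)
  also have "\<dots> = (\<Sum>k<m * n. f (k div n) (k mod n))"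
    by (rule sum.reindex_bij_witness[of _ "\<lambda>k. (k div n, k mod n)" "\<lambda>(i, j). i * n + j"])
      (auto simp: div_mod_less_mult intro: bound)
  finally show ?thesis by simp
qed

lemma mult_mat_index_sum:
  fixes A B :: "complex mat"
  assumes "i < dim_row A" "j < dim_col B" "dim_row B = dim_col A"
  shows "(A * B) $$ (i, j) = (\<Sum>k<dim_col A. A $$ (i, k) * B $$ (k, j))"
  using assms by (auto simp: scalar_prod_def lessThan_atLeast0 intro!: sum.cong)

lemma tensor_vec_dim [simp]: "dim_vec (tensor_vec u v) = dim_vec u * dim_vec v"
  by (simp add: tensor_vec_def)

lemma tensor_vec_index [simp]:
  "i < dim_vec u * dim_vec v \<Longrightarrow> tensor_vec u v $ i = u $ (i div dim_vec v) * v $ (i mod dim_vec v)"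
  by (simp add: tensor_vec_def)

lemma tensor_mat_dim [simp]:
  "dim_row (tensor_mat A B) = dim_row A * dim_row B"
  "dim_col (tensor_mat A B) = dim_col A * dim_col B"
  by (simp_all add: tensor_mat_def)

lemma tensor_mat_index [simp]:
  "i < dim_row A * dim_row B \<Longrightarrow> j < dim_col A * dim_col B \<Longrightarrow>
   tensor_mat A B $$ (i, j)
     = A $$ (i div dim_row B, j div dim_col B) * B $$ (i mod dim_row B, j mod dim_col B)"
  by (simp add: tensor_mat_def)

text \<open>The mixed-product rule: once the joint summation index is split into a pair, each
  summand is a product of a term in the first index and a term in the second, so the double sum
  factorises.\<close>

lemma tensor_mat_mult:
  assumes "dim_col A = dim_row A'" "dim_col B = dim_row B'"
  shows "tensor_mat A B * tensor_mat A' B' = tensor_mat (A * A') (B * B')"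
proof (rule eq_matI)
  let ?n = "dim_row A'" and ?l = "dim_row B'"
  fix i j assume "i < dim_row (tensor_mat (A * A') (B * B'))" "j < dim_col (tensor_mat (A * A') (B * B'))"
  then have i: "i < dim_row A * dim_row B" and j: "j < dim_col A' * dim_col B'" by auto
  define i1 i2 j1 j2
    where d: "i1 = i div dim_row B" "i2 = i mod dim_row B" "j1 = j div dim_col B'" "j2 = j mod dim_col B'"
  have b: "i1 < dim_row A" "i2 < dim_row B" "j1 < dim_col A'" "j2 < dim_col B'"
    using i j by (auto simp: d div_mod_less_mult)
  have "(tensor_mat A B * tensor_mat A' B') $$ (i, j)
      = (\<Sum>k<?n * ?l. tensor_mat A B $$ (i, k) * tensor_mat A' B' $$ (k, j))"
    using i j assms by (subst mult_mat_index_sum) auto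
  also have "\<dots> = (\<Sum>k<?n * ?l. (A $$ (i1, k div ?l) * B $$ (i2, k mod ?l))
      * (A' $$ (k div ?l, j1) * B' $$ (k mod ?l, j2)))"
    using i j assms by (auto simp: d intro!: sum.cong)
  also have "\<dots> = (\<Sum>x<?n. \<Sum>y<?l. (A $$ (i1, x) * B $$ (i2, y)) * (A' $$ (x, j1) * B' $$ (y, j2)))"
    by (rule sum_lessThan_mult_div_mod)
  also have "\<dots> = (\<Sum>x<?n. A $$ (i1, x) * A' $$ (x, j1)) * (\<Sum>y<?l. B $$ (i2, y) * B' $$ (y, j2))"
    by (simp add: sum_product mult_ac)
  also have "\<dots> = (A * A') $$ (i1, j1) * (B * B') $$ (i2, j2)"
    using b assms by (simp add: mult_mat_index_sum del: index_mult_mat(1))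
  also have "\<dots> = tensor_mat (A * A') (B * B') $$ (i, j)"
    using i j by (subst tensor_mat_index) (simp_all add: d)
  finally show "(tensor_mat A B * tensor_mat A' B') $$ (i, j) = tensor_mat (A * A') (B * B') $$ (i, j)" .
qed auto

lemma tensor_mat_mult_vec:
  assumes "dim_col A = dim_vec u" "dim_col B = dim_vec v"
  shows "tensor_mat A B *\<^sub>v tensor_vec u v = tensor_vec (A *\<^sub>v u) (B *\<^sub>v v)"
proof (rule eq_vecI)
  let ?n = "dim_vec u" and ?l = "dim_vec v"
  fix i assume "i < dim_vec (tensor_vec (A *\<^sub>v u) (B *\<^sub>v v))"
  then have i: "i < dim_row A * dim_row B" by auto
  define i1 i2 where d: "i1 = i div dim_row B" "i2 = i mod dim_row B"
  have b: "i1 < dim_row A" "i2 < dim_row B"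
    using i by (auto simp: d div_mod_less_mult)
  have "(tensor_mat A B *\<^sub>v tensor_vec u v) $ i
      = (\<Sum>k<?n * ?l. tensor_mat A B $$ (i, k) * tensor_vec u v $ k)"
    using i assms by (subst mult_mat_vec_sum) auto
  also have "\<dots> = (\<Sum>k<?n * ?l. (A $$ (i1, k div ?l) * B $$ (i2, k mod ?l))
      * (u $ (k div ?l) * v $ (k mod ?l)))"
    using i assms by (auto simp: d intro!: sum.cong)
  also have "\<dots> = (\<Sum>x<?n. \<Sum>y<?l. (A $$ (i1, x) * B $$ (i2, y)) * (u $ x * v $ y))"
    by (rule sum_lessThan_mult_div_mod)
  also have "\<dots> = (\<Sum>x<?n. A $$ (i1, x) * u $ x) * (\<Sum>y<?l. B $$ (i2, y) * v $ y)"
    by (simp add: sum_product mult_ac)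
  also have "\<dots> = (A *\<^sub>v u) $ i1 * (B *\<^sub>v v) $ i2"
    using b assms by (simp add: mult_mat_vec_sum del: index_mult_mat_vec)
  also have "\<dots> = tensor_vec (A *\<^sub>v u) (B *\<^sub>v v) $ i"
    using i by (subst tensor_vec_index) (simp_all add: d)
  finally show "(tensor_mat A B *\<^sub>v tensor_vec u v) $ i = tensor_vec (A *\<^sub>v u) (B *\<^sub>v v) $ i" .
qed auto

lemma tensor_vec_cscalar_prod:
  assumes "dim_vec u = dim_vec u'" "dim_vec v = dim_vec v'"
  shows "tensor_vec u v \<bullet>c tensor_vec u' v' = (u \<bullet>c u') * (v \<bullet>c v')"
proof -
  let ?n = "dim_vec u'" and ?l = "dim_vec v'"
  have "tensor_vec u v \<bullet>c tensor_vec u' v'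
      = (\<Sum>k<?n * ?l. (u $ (k div ?l) * v $ (k mod ?l)) * cnj (u' $ (k div ?l) * v' $ (k mod ?l)))"
    using assms by (auto simp: cscalar_prod_sum intro!: sum.cong)
  also have "\<dots> = (\<Sum>x<?n. \<Sum>y<?l. (u $ x * v $ y) * cnj (u' $ x * v' $ y))"
    by (rule sum_lessThan_mult_div_mod)
  also have "\<dots> = (u \<bullet>c u') * (v \<bullet>c v')"
    by (simp add: cscalar_prod_sum sum_product mult_ac)
  finally show ?thesis .
qed

lemma sq_norm2_tensor_vec: "sq_norm2 (tensor_vec u v) = sq_norm2 u * sq_norm2 v"
proof -
  have "complex_of_real (sq_norm2 (tensor_vec u v)) = complex_of_real (sq_norm2 u * sq_norm2 v)"
    by (simp only: of_real_mult sq_norm2_cscalar_prod tensor_vec_cscalar_prod)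
  then show ?thesis by (simp only: of_real_eq_iff)
qed

lemma tensor_state_vec:
  "state_vec m u \<Longrightarrow> state_vec n v \<Longrightarrow> state_vec (m * n) (tensor_vec u v)"
  by (simp add: state_vec_def sq_norm2_tensor_vec)

lemma tensor_mat_adjoint: "mat_adjoint (tensor_mat A B) = tensor_mat (mat_adjoint A) (mat_adjoint B)"
  by (rule eq_matI) (auto simp: div_mod_less_mult)

lemma tensor_mat_one: "tensor_mat (1\<^sub>m m) (1\<^sub>m n) = 1\<^sub>m (m * n)"
proof (rule eq_matI)
  fix i j assume "i < dim_row (1\<^sub>m (m * n))" "j < dim_col (1\<^sub>m (m * n))"
  then have ij: "i < m * n" "j < m * n" by auto
  have "i = j \<longleftrightarrow> i div n = j div n \<and> i mod n = j mod n"
    by (metis div_mult_mod_eq)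
  then show "tensor_mat (1\<^sub>m m) (1\<^sub>m n) $$ (i, j) = 1\<^sub>m (m * n) $$ (i, j)"
    using ij by (auto simp: div_mod_less_mult)
qed auto

lemma tensor_mat_add_left:
  assumes "A \<in> carrier_mat m n" "A' \<in> carrier_mat m n" "B \<in> carrier_mat k l"
  shows "tensor_mat (A + A') B = tensor_mat A B + tensor_mat A' B"
  using assms by (intro eq_matI) (auto simp: div_mod_less_mult algebra_simps)

lemma tensor_mat_zero_left:
  assumes "B \<in> carrier_mat k l"
  shows "tensor_mat (0\<^sub>m m n) B = 0\<^sub>m (m * k) (n * l)"
  using assms by (intro eq_matI) (auto simp: div_mod_less_mult)

lemma tensor_vec_zero_right: "tensor_vec u (0\<^sub>v n) = 0\<^sub>v (dim_vec u * n)"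
  by (intro eq_vecI) (auto simp: div_mod_less_mult)

lemma unitary_mat_tensor:
  assumes "unitary_mat m U" "unitary_mat n V"
  shows "unitary_mat (m * n) (tensor_mat U V)"
  using assms
  by (auto simp: unitary_mat_def tensor_mat_adjoint tensor_mat_mult tensor_mat_one)

lemma projector_mat_tensor:
  assumes "projector_mat m P" "projector_mat n R"
  shows "projector_mat (m * n) (tensor_mat P R)"
  using assms
  by (auto simp: projector_mat_def tensor_mat_adjoint tensor_mat_mult)

section \<open>Projectors and reflections controlled by them\<close>

lemma projector_mat_complement:
  assumes "projector_mat n P"
  shows "projector_mat n (1\<^sub>m n - P)" "P * (1\<^sub>m n - P) = 0\<^sub>m n n" "(1\<^sub>m n - P) * P = 0\<^sub>m n n"
proof -
  have [simp]: "P \<in> carrier_mat n n" and adj: "mat_adjoint P = P" and sq: "P * P = P"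
    using assms by (auto simp: projector_mat_def)
  have "P * (1\<^sub>m n - P) = P * 1\<^sub>m n - P * P"
    by (rule mult_minus_distrib_mat[of _ n n _ n]) auto
  then show 1: "P * (1\<^sub>m n - P) = 0\<^sub>m n n" by (simp add: sq right_mult_one_mat[of _ n n])
  have "(1\<^sub>m n - P) * P = 1\<^sub>m n * P - P * P"
    by (rule minus_mult_distrib_mat[of _ n n _ _ n]) auto
  then show "(1\<^sub>m n - P) * P = 0\<^sub>m n n" by (simp add: sq left_mult_one_mat[of _ n n])
  have "(1\<^sub>m n - P) * (1\<^sub>m n - P) = 1\<^sub>m n * (1\<^sub>m n - P) - P * (1\<^sub>m n - P)"
    by (rule minus_mult_distrib_mat[of _ n n _ _ n]) (auto intro: minus_carrier_mat)
  also have "\<dots> = 1\<^sub>m n - P"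
    using carrier_matD[OF \<open>P \<in> carrier_mat n n\<close>]
    by (simp add: 1 left_mult_one_mat[of _ n n] minus_carrier_mat) (rule eq_matI, auto)
  finally show "projector_mat n (1\<^sub>m n - P)"
    by (simp add: projector_mat_def mat_adjoint_minus[of _ n n] adj minus_carrier_mat)
qed

text \<open>In \<open>G * G\<close> the cross terms vanish because \<open>P\<close> and
  \<open>1 - P\<close> annihilate each other; the two squares have the same second factor
  \<open>1\<close> and add up to \<open>(P + (1 - P)) \<otimes> 1\<close>.\<close>

lemma controlled_reflection:
  assumes P: "projector_mat n P"
    and A: "A \<in> carrier_mat k k" "mat_adjoint A = A" "A * A = 1\<^sub>m k"
    and B: "B \<in> carrier_mat k k" "mat_adjoint B = B" "B * B = 1\<^sub>m k"
  defines "G \<equiv> tensor_mat P A + tensor_mat (1\<^sub>m n - P) B"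
  shows "G \<in> carrier_mat (n * k) (n * k)" "mat_adjoint G = G" "G * G = 1\<^sub>m (n * k)"
proof -
  let ?R = "1\<^sub>m n - P" and ?N = "n * k"
  note R = projector_mat_complement[OF P]
  have [simp]: "P \<in> carrier_mat n n" "?R \<in> carrier_mat n n"
    and adj: "mat_adjoint P = P" "mat_adjoint ?R = ?R" and sq: "P * P = P" "?R * ?R = ?R"
    using P R(1) by (simp_all only: projector_mat_def)
  have [simp]: "tensor_mat P A \<in> carrier_mat ?N ?N" "tensor_mat ?R B \<in> carrier_mat ?N ?N"
    using A B by simp_all
  show G: "G \<in> carrier_mat ?N ?N" by (simp add: G_def)
  show "mat_adjoint G = G"
    by (simp add: G_def mat_adjoint_add[of _ ?N ?N] tensor_mat_adjoint adj A B)
  have dims: "dim_row P = n" "dim_col P = n" "dim_row ?R = n" "dim_col ?R = n"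
    "dim_row A = k" "dim_col A = k" "dim_row B = k" "dim_col B = k"
    using A(1) B(1) carrier_matD[OF \<open>P \<in> carrier_mat n n\<close>] by auto
  have "G * G = tensor_mat P A * G + tensor_mat ?R B * G"
    unfolding G_def by (rule add_mult_distrib_mat[of _ ?N ?N _ _ ?N]) auto
  also have "tensor_mat P A * G = tensor_mat P A * tensor_mat P A + tensor_mat P A * tensor_mat ?R B"
    unfolding G_def by (rule mult_add_distrib_mat[of _ ?N ?N _ ?N]) auto
  also have "\<dots> = tensor_mat P (1\<^sub>m k) + 0\<^sub>m ?N ?N"
    using tensor_mat_zero_left[OF mult_carrier_mat[OF A(1) B(1)]]
    by (simp only: tensor_mat_mult dims sq R A(3))
  also have "\<dots> = tensor_mat P (1\<^sub>m k)"
    by (rule right_add_zero_mat[of _ ?N ?N]) simp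
  also have "tensor_mat ?R B * G = tensor_mat ?R B * tensor_mat P A + tensor_mat ?R B * tensor_mat ?R B"
    unfolding G_def by (rule mult_add_distrib_mat[of _ ?N ?N _ ?N]) auto
  also have "\<dots> = 0\<^sub>m ?N ?N + tensor_mat ?R (1\<^sub>m k)"
    using tensor_mat_zero_left[OF mult_carrier_mat[OF B(1) A(1)]]
    by (simp only: tensor_mat_mult dims sq R B(3))
  also have "\<dots> = tensor_mat ?R (1\<^sub>m k)"
    by (rule left_add_zero_mat[of _ ?N ?N]) simp
  also have "tensor_mat P (1\<^sub>m k) + tensor_mat ?R (1\<^sub>m k) = tensor_mat (P + ?R) (1\<^sub>m k)"
    by (rule tensor_mat_add_left[symmetric, of _ n n _ _ k k]) auto
  also have "P + ?R = 1\<^sub>m n"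
    using dims by (intro eq_matI) auto
  finally show "G * G = 1\<^sub>m ?N" by (simp add: tensor_mat_one)
qed

lemma unit_vec_state: "i < n \<Longrightarrow> state_vec n (unit_vec n i)"
proof -
  assume i: "i < n"
  have "sq_norm2 (unit_vec n i) = (\<Sum>j<n. if j = i then 1 else 0)"
    unfolding sq_norm2_def using i by (intro sum.cong) auto
  then show ?thesis using i by (simp add: state_vec_def)
qed

lemma smult_add_smult_mult_mat_vec:
  fixes A :: "complex mat"
  assumes "A \<in> carrier_mat m n" "u \<in> carrier_vec n" "v \<in> carrier_vec n"
  shows "A *\<^sub>v (a \<cdot>\<^sub>v u + b \<cdot>\<^sub>v v) = a \<cdot>\<^sub>v (A *\<^sub>v u) + b \<cdot>\<^sub>v (A *\<^sub>v v)"
  using assms by (simp add: mult_add_distrib_mat_vec[of _ m n] mult_mat_vec[of _ m n])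

lemma unitary_mat_cancel:
  assumes "unitary_mat n U" "v \<in> carrier_vec n"
  shows "U *\<^sub>v (mat_adjoint U *\<^sub>v v) = v" "mat_adjoint U *\<^sub>v (U *\<^sub>v v) = v"
  using assms by (simp_all add: unitary_mat_def flip: assoc_mult_mat_vec[of _ n n _ n])

text \<open>Any nonzero vector \<open>P v\<close> is fixed by \<open>P\<close> through idempotence
  and only has to be normalised. It serves as the target of the last reflection of the
  circuit.\<close>

lemma projector_range_state:
  assumes P: "projector_mat n P" and nz: "P \<noteq> 0\<^sub>m n n"
  shows "\<exists>\<chi>. state_vec n \<chi> \<and> P *\<^sub>v \<chi> = \<chi>"
proof -
  have Pc: "P \<in> carrier_mat n n" and PP: "P * P = P" using P by (auto simp: projector_mat_def)
  obtain v where v: "v \<in> carrier_vec n" "P *\<^sub>v v \<noteq> 0\<^sub>m n n *\<^sub>v v"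
    using mat_eqI_mult_vec[OF Pc, of "0\<^sub>m n n"] nz by auto
  define u where "u = P *\<^sub>v v"
  have u: "u \<in> carrier_vec n" "u \<noteq> 0\<^sub>v n" and Pu: "P *\<^sub>v u = u"
    using v Pc PP by (auto simp: u_def simp flip: assoc_mult_mat_vec[of _ n n _ n])
  have "sq_norm2 u > 0"
  proof -
    have "sq_norm2 u \<ge> 0" by (simp add: sq_norm2_def sum_nonneg)
    moreover have "sq_norm2 u \<noteq> 0"
    proof
      assume "sq_norm2 u = 0"
      then have "u \<bullet>c u = 0" by (simp flip: sq_norm2_cscalar_prod)
      with u show False by simp
    qed
    ultimately show ?thesis by simp
  qed
  define c where "c = complex_of_real (1 / sqrt (sq_norm2 u))"
  have "sq_norm2 (c \<cdot>\<^sub>v u) = (cmod c)\<^sup>2 * sq_norm2 u"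
    by (simp add: sq_norm2_def norm_mult power_mult_distrib sum_distrib_left)
  also have "\<dots> = 1"
    using \<open>sq_norm2 u > 0\<close> by (simp add: c_def norm_divide power_divide)
  finally have "state_vec n (c \<cdot>\<^sub>v u)" using u by (simp add: state_vec_def)
  moreover have "P *\<^sub>v (c \<cdot>\<^sub>v u) = c \<cdot>\<^sub>v u" using mult_mat_vec[OF Pc u(1)] Pu by simp
  ultimately show ?thesis by blast
qed

section \<open>Running a list of steps on a vector\<close>

lemma steps_mat_unitary:
  assumes "\<And>s. s \<in> set ss \<Longrightarrow> unitary_mat (dim_vec (input Q) * 2 ^ k) (step_mat k Q s)"
  shows "unitary_mat (dim_vec (input Q) * 2 ^ k) (steps_mat k Q ss)"
  using assms by (induction ss) (auto intro: unitary_mat_mult unitary_mat_one)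

text \<open>Later steps are multiplied on the left, so the product applied to a vector is a
  \<open>fold\<close> from the head of the list. Unitarity of the steps supplies the dimensions
  needed for associativity.\<close>

lemma steps_mat_mult_vec:
  assumes "\<And>s. s \<in> set ss \<Longrightarrow> unitary_mat (dim_vec (input Q) * 2 ^ k) (step_mat k Q s)"
    and "v \<in> carrier_vec (dim_vec (input Q) * 2 ^ k)"
  shows "steps_mat k Q ss *\<^sub>v v = fold (\<lambda>s. (*\<^sub>v) (step_mat k Q s)) ss v"
  using assms
proof (induction ss arbitrary: v)
  case (Cons s ss)
  let ?N = "dim_vec (input Q) * 2 ^ k"
  have s: "step_mat k Q s \<in> carrier_mat ?N ?N" and ss: "steps_mat k Q ss \<in> carrier_mat ?N ?N"
    using Cons.prems(1) steps_mat_unitary[of ss Q k] by (auto simp: unitary_mat_def)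
  have "steps_mat k Q (s # ss) *\<^sub>v v = steps_mat k Q ss *\<^sub>v (step_mat k Q s *\<^sub>v v)"
    using assoc_mult_mat_vec[OF ss s Cons.prems(2)] by simp
  also have "\<dots> = fold (\<lambda>s. (*\<^sub>v) (step_mat k Q s)) ss (step_mat k Q s *\<^sub>v v)"
    using Cons s by (intro Cons.IH) (auto intro: mult_mat_vec_carrier)
  finally show ?case by simp
qed simp

text \<open>Turns the repeated block of the circuit into the iterate of a single map.\<close>

lemma fold_concat_replicate: "fold f (concat (replicate m xs)) = fold f xs ^^ m"
  by (induction m) (simp_all add: funpow_swap1 fun_eq_iff)

text \<open>On coefficients, \<open>T\<close> is the companion map of the recurrence
  \<open>x (m + 1) = 2 cos \<phi> x m - x (m - 1)\<close>. Starting from \<open>(0, 1)\<close>, its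
  solutions are Chebyshev polynomials of the second kind at \<open>cos \<phi>\<close>, written as
  quotients of sines. Only coefficients are tracked; \<open>e\<close> and \<open>f\<close> will in
  general not be orthogonal.\<close>

lemma plane_rotation_iterate:
  fixes e f :: "complex vec" and \<phi> :: real
  assumes e: "e \<in> carrier_vec n" and f: "f \<in> carrier_vec n" and "sin \<phi> \<noteq> 0"
    and T: "\<And>a b. T (a \<cdot>\<^sub>v e + b \<cdot>\<^sub>v f) = b \<cdot>\<^sub>v e + (2 * complex_of_real (cos \<phi>) * b - a) \<cdot>\<^sub>v f"
  shows "(T ^^ m) f = complex_of_real (sin (m * \<phi>) / sin \<phi>) \<cdot>\<^sub>v e
    + complex_of_real (sin (Suc m * \<phi>) / sin \<phi>) \<cdot>\<^sub>v f"
proof (induction m)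
  case 0
  show ?case using assms by (intro eq_vecI) auto
next
  case (Suc m)
  \<comment> \<open>Add the formulas for the sine of \<open>Suc m * \<phi>\<close> plus and minus
    \<open>\<phi>\<close>; the cosine terms cancel.\<close>
  have "sin (Suc (Suc m) * \<phi>) + sin (m * \<phi>) = 2 * cos \<phi> * sin (Suc m * \<phi>)"
    using sin_add[of "Suc m * \<phi>" \<phi>] sin_diff[of "Suc m * \<phi>" \<phi>] by (simp add: algebra_simps)
  then have "2 * cos \<phi> * (sin (Suc m * \<phi>) / sin \<phi>) - sin (m * \<phi>) / sin \<phi> = sin (Suc (Suc m) * \<phi>) / sin \<phi>"
    by (simp add: diff_divide_distrib[symmetric] eq_diff_eq[symmetric])
  from arg_cong[OF this, of complex_of_real]
  have *: "2 * complex_of_real (cos \<phi>) * complex_of_real (sin (Suc m * \<phi>) / sin \<phi>)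
      - complex_of_real (sin (m * \<phi>) / sin \<phi>) = complex_of_real (sin (Suc (Suc m) * \<phi>) / sin \<phi>)"
    by (simp only: of_real_diff of_real_mult of_real_numeral)
  have "(T ^^ Suc m) f = T (complex_of_real (sin (m * \<phi>) / sin \<phi>) \<cdot>\<^sub>v e
    + complex_of_real (sin (Suc m * \<phi>) / sin \<phi>) \<cdot>\<^sub>v f)"
    by (simp only: funpow.simps o_apply Suc.IH)
  also have "\<dots> = complex_of_real (sin (Suc m * \<phi>) / sin \<phi>) \<cdot>\<^sub>v e
      + complex_of_real (sin (Suc (Suc m) * \<phi>) / sin \<phi>) \<cdot>\<^sub>v f"
    unfolding T * ..
  finally show ?case .
qed

text \<open>The reflection along this vector has upper left entry \<open>a\<close> and fixes the levels \<open>2\<close> and \<open>3\<close>.\<close>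

definition mix_vec :: "real \<Rightarrow> complex vec" where
  "mix_vec a = vec 4 (\<lambda>i. if i = 0 then complex_of_real (sqrt ((1 - a) / 2))
     else if i = 1 then - complex_of_real (sqrt ((1 + a) / 2)) else 0)"

abbreviation mix_mat :: "real \<Rightarrow> complex mat" where
  "mix_mat a \<equiv> householder (mix_vec a)"

lemma sum_lessThan_4: "(\<Sum>i<4. f i) = f 0 + f 1 + f 2 + f (3::nat)"
  by (simp add: eval_nat_numeral)

lemma mix_vec_state: "\<bar>a\<bar> \<le> 1 \<Longrightarrow> state_vec 4 (mix_vec a)"
  by (auto simp: state_vec_def sq_norm2_def mix_vec_def sum_lessThan_4 field_simps)

text \<open>The entry at level \<open>0\<close> is \<open>1 - 2 (1 - a) / 2 = a\<close>. The zero at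
  level \<open>2\<close> is what keeps the flag level empty until the last gate.\<close>

lemma mix_mat_zero:
  assumes "\<bar>a\<bar> \<le> 1"
  shows "mix_mat a *\<^sub>v unit_vec 4 0 \<in> carrier_vec 4"
    "(mix_mat a *\<^sub>v unit_vec 4 0) $ 0 = complex_of_real a"
    "(mix_mat a *\<^sub>v unit_vec 4 0) $ 2 = 0"
proof -
  have c: "mix_vec a \<in> carrier_vec 4" by (simp add: mix_vec_def)
  have z: "mix_mat a *\<^sub>v unit_vec 4 0
      = unit_vec 4 0 - (2 * complex_of_real (sqrt ((1 - a) / 2))) \<cdot>\<^sub>v mix_vec a"
    using householder_mult_vec[OF c unit_vec_carrier[of 4 0]]
    by (simp add: cscalar_prod_sum sum_lessThan_4 mix_vec_def)
  show "mix_mat a *\<^sub>v unit_vec 4 0 \<in> carrier_vec 4" "(mix_mat a *\<^sub>v unit_vec 4 0) $ 2 = 0"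
    unfolding z using c by (auto simp: mix_vec_def)
  have "sqrt ((1 - a) / 2) * sqrt ((1 - a) / 2) = (1 - a) / 2" using assms by simp
  then have "complex_of_real (sqrt ((1 - a) / 2)) * complex_of_real (sqrt ((1 - a) / 2))
      = complex_of_real ((1 - a) / 2)"
    by (metis of_real_mult)
  then have "2 * complex_of_real (sqrt ((1 - a) / 2)) * complex_of_real (sqrt ((1 - a) / 2))
      = 1 - complex_of_real a"
    by (simp add: mult_ac)
  then show "(mix_mat a *\<^sub>v unit_vec 4 0) $ 0 = complex_of_real a"
    unfolding z by (simp add: mix_vec_def)
qed

text \<open>The projector \<open>|2><2|\<close>. Levels \<open>0\<close> and \<open>1\<close> carry
  the \<open>2 \<times> 2\<close> reflections; a free third level requires two ancilla qubits, hence
  dimension \<open>4\<close>.\<close>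

definition flag_proj :: "complex mat" where
  "flag_proj = mat 4 4 (\<lambda>(i, j). if i = 2 \<and> j = 2 then 1 else 0)"

lemma flag_proj_carrier [simp]: "flag_proj \<in> carrier_mat 4 4"
  by (simp add: flag_proj_def)

lemma flag_proj_mult_vec:
  assumes "v \<in> carrier_vec 4"
  shows "flag_proj *\<^sub>v v = v $ 2 \<cdot>\<^sub>v unit_vec 4 2"
proof (rule eq_vecI)
  fix i assume "i < dim_vec (v $ 2 \<cdot>\<^sub>v unit_vec 4 2)"
  with assms show "(flag_proj *\<^sub>v v) $ i = (v $ 2 \<cdot>\<^sub>v unit_vec 4 2) $ i"
    by (subst mult_mat_vec_sum) (auto simp: flag_proj_def sum_lessThan_4)
qed (simp add: flag_proj_def)

lemma flag_proj_projector: "projector_mat 4 flag_proj"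
  unfolding projector_mat_def
proof (intro conjI)
  show "mat_adjoint flag_proj = flag_proj"
    by (rule eq_matI) (auto simp: flag_proj_def)
  show "flag_proj * flag_proj = flag_proj"
    by (rule eq_matI) (auto simp: mult_mat_index_sum flag_proj_def sum_lessThan_4 simp del: index_mult_mat(1))
qed simp

subsection \<open>The transform\<close>

definition swap_mat :: "complex vec \<Rightarrow> complex vec \<Rightarrow> complex mat" where
  "swap_mat u u' = householder (complex_of_real (1 / sqrt 2) \<cdot>\<^sub>v (u - u'))"

text \<open>For orthonormal \<open>u\<close>, \<open>u'\<close> the vector
  \<open>w = (u - u') / sqrt 2\<close> has norm \<open>1\<close> and overlap
  \<open>1 / sqrt 2\<close> with \<open>u\<close>, so reflecting \<open>u\<close> subtracts exactly
  \<open>u - u'\<close>. A vector orthogonal to both is orthogonal to \<open>w\<close> and stays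
  fixed.\<close>

lemma swap_mat:
  assumes u: "state_vec n u" and u': "state_vec n u'" and orth: "u \<bullet>c u' = 0"
  shows "unitary_mat n (swap_mat u u')"
    and "swap_mat u u' *\<^sub>v u = u'"
    and "v \<in> carrier_vec n \<Longrightarrow> v \<bullet>c u = 0 \<Longrightarrow> v \<bullet>c u' = 0 \<Longrightarrow> swap_mat u u' *\<^sub>v v = v"
proof -
  define c where "c = complex_of_real (1 / sqrt 2)"
  define w where "w = c \<cdot>\<^sub>v (u - u')"
  have swap: "swap_mat u u' = householder w" by (simp only: swap_mat_def w_def c_def)
  have cc: "2 * (c * c) = 1" by (simp add: c_def flip: of_real_mult)
  have cnj_c: "cnj c = c" by (simp add: c_def)
  have cu: "u \<in> carrier_vec n" "u' \<in> carrier_vec n" using u u' by (auto simp: state_vec_def)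
  have cw: "w \<in> carrier_vec n" using cu by (simp add: w_def)
  have uu: "u \<bullet>c u = 1" "u' \<bullet>c u' = 1"
    using u u' by (simp_all add: state_vec_def flip: sq_norm2_cscalar_prod)
  have orth': "u' \<bullet>c u = 0" using orth cu cscalar_prod_commute[of u' n u] by simp
  \<comment> \<open>The product is linear on the left, so \<open>w\<close> is expanded there and the
    result conjugated; \<open>c\<close> is real.\<close>
  have vw: "v \<bullet>c w = c * (v \<bullet>c u - v \<bullet>c u')" if "v \<in> carrier_vec n" for v
  proof -
    have "w \<bullet>c v = c * (u \<bullet>c v - u' \<bullet>c v)"
      using cu that
      by (simp add: w_def cscalar_prod_smult_left[of _ n] cscalar_prod_minus_left[of _ n])
    then show ?thesis
      using cu that cw cscalar_prod_commute[of v n w] cscalar_prod_commute[of v n u]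
        cscalar_prod_commute[of v n u'] by (simp add: cnj_c)
  qed
  have "w \<bullet>c w = c * (c * (u \<bullet>c u - u' \<bullet>c u) - c * (u \<bullet>c u' - u' \<bullet>c u'))"
    using cu cw by (subst vw)
      (simp_all add: w_def cscalar_prod_smult_left[of _ n] cscalar_prod_minus_left[of _ n])
  also have "\<dots> = 1" using cc by (simp add: uu orth orth' mult.left_commute)
  finally have "complex_of_real (sq_norm2 w) = complex_of_real 1"
    by (simp only: sq_norm2_cscalar_prod of_real_1)
  then have "sq_norm2 w = 1" by (simp only: of_real_eq_iff)
  with cw show "unitary_mat n (swap_mat u u')"
    by (simp add: swap householder_unitary state_vec_def)
  have "swap_mat u u' *\<^sub>v u = u - (2 * c) \<cdot>\<^sub>v w"
    using householder_mult_vec[OF cw cu(1)] vw[OF cu(1)]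
    by (simp add: swap uu orth)
  also have "(2 * c) \<cdot>\<^sub>v w = u - u'"
    unfolding w_def smult_smult_assoc using cc by (simp add: mult.assoc)
  also have "u - (u - u') = u'" using cu by (intro eq_vecI) auto
  finally show "swap_mat u u' *\<^sub>v u = u'" .
  show "swap_mat u u' *\<^sub>v v = v" if "v \<in> carrier_vec n" "v \<bullet>c u = 0" "v \<bullet>c u' = 0"
  proof -
    have "swap_mat u u' *\<^sub>v v = v - 0 \<cdot>\<^sub>v w"
      using householder_mult_vec[OF cw that(1)] vw[OF that(1)] that
      by (simp add: swap)
    also have "\<dots> = v" using that(1) cw by (intro eq_vecI) auto
    finally show ?thesis .
  qed
qed

text \<open>The reflection with parameter \<open>a\<close> on the range of \<open>P\<close> and the
  one with parameter \<open>b\<close> on its complement. The state \<open>\<psi>\<close> contributes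
  only its dimension.\<close>

definition mix_gate :: "real \<Rightarrow> real \<Rightarrow> complex mat \<Rightarrow> complex vec \<Rightarrow> complex mat" where
  "mix_gate a b P \<psi> = tensor_mat P (mix_mat a) + tensor_mat (1\<^sub>m (dim_vec \<psi>) - P) (mix_mat b)"

definition reflect_gate :: "complex mat \<Rightarrow> complex vec \<Rightarrow> complex mat" where
  "reflect_gate P \<psi> = householder (tensor_vec \<psi> (unit_vec 4 0))"

text \<open>Gates are functions of \<open>P\<close> and \<open>\<psi>\<close>, so the target state
  has to be a fixed choice determined by \<open>P\<close>.\<close>

definition range_state :: "complex mat \<Rightarrow> complex vec" where
  "range_state P = (SOME \<chi>. state_vec (dim_row P) \<chi> \<and> P *\<^sub>v \<chi> = \<chi>)"

text \<open>If \<open>P = 0\<close>, then \<open>range_state P\<close> is an arbitrary vector, and outcome \<open>E\<close> cannot occur anyway.\<close>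

definition flag_gate :: "complex mat \<Rightarrow> complex vec \<Rightarrow> complex mat" where
  "flag_gate P \<psi> = (if P = 0\<^sub>m (dim_row P) (dim_row P) then 1\<^sub>m (dim_vec \<psi> * 4)
     else swap_mat (tensor_vec \<psi> (unit_vec 4 0)) (tensor_vec (range_state P) (unit_vec 4 2)))"

definition encode_steps :: "real \<Rightarrow> real \<Rightarrow> step list" where
  "encode_steps a b = [Call_C, Gate (mix_gate a b), Call_C_adj]"

text \<open>With \<open>m\<close> reflections in between, the encoding block occurs
  \<open>m + 1\<close> times; the odd number \<open>n = 2 l + 1\<close> of uses thus corresponds to
  \<open>m = 2 * l\<close>. The ancilla count \<open>2\<close> yields the factor \<open>4\<close> in
  all dimensions.\<close>

definition amplify_transform :: "real \<Rightarrow> real \<Rightarrow> nat \<Rightarrow> transform" where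
  "amplify_transform a b m = Transform 2 flag_proj
     (encode_steps a b @ concat (replicate m (Gate reflect_gate # encode_steps a b)) @ [Gate flag_gate])"

lemma range_state:
  assumes "projector_mat n P" "P \<noteq> 0\<^sub>m n n"
  shows "state_vec n (range_state P)" "P *\<^sub>v range_state P = range_state P"
proof -
  have "dim_row P = n" using assms by (auto simp: projector_mat_def)
  with someI_ex[OF projector_range_state[OF assms]]
  show "state_vec n (range_state P)" "P *\<^sub>v range_state P = range_state P"
    by (simp_all add: range_state_def)
qed

lemma mix_gate:
  assumes "projector_mat n P" "state_vec n \<psi>" "\<bar>a\<bar> \<le> 1" "\<bar>b\<bar> \<le> 1"
  shows "mix_gate a b P \<psi> \<in> carrier_mat (n * 4) (n * 4)"
    and "mix_gate a b P \<psi> * mix_gate a b P \<psi> = 1\<^sub>m (n * 4)"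
    and "unitary_mat (n * 4) (mix_gate a b P \<psi>)"
proof -
  have n: "dim_vec \<psi> = n" using assms by (auto simp: state_vec_def)
  have st: "state_vec 4 (mix_vec a)" "state_vec 4 (mix_vec b)"
    using assms by (auto intro: mix_vec_state)
  then have c: "mix_mat a \<in> carrier_mat 4 4" "mix_mat b \<in> carrier_mat 4 4"
    by (auto simp: state_vec_def)
  note G = controlled_reflection[OF assms(1) c(1) householder_adjoint householder_square[OF st(1)]
      c(2) householder_adjoint householder_square[OF st(2)]]
  show "mix_gate a b P \<psi> \<in> carrier_mat (n * 4) (n * 4)"
    "mix_gate a b P \<psi> * mix_gate a b P \<psi> = 1\<^sub>m (n * 4)"
    "unitary_mat (n * 4) (mix_gate a b P \<psi>)"
    using G by (simp_all add: mix_gate_def n unitary_mat_def)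
qed

lemma reflect_gate_unitary:
  assumes "state_vec n \<psi>"
  shows "unitary_mat (n * 4) (reflect_gate P \<psi>)"
  unfolding reflect_gate_def
  by (intro householder_unitary tensor_state_vec assms unit_vec_state) simp

lemma tensor_vec_zero_two_orthogonal:
  assumes "dim_vec u = dim_vec v"
  shows "tensor_vec u (unit_vec 4 0) \<bullet>c tensor_vec v (unit_vec 4 2) = 0"
  using assms by (simp add: tensor_vec_cscalar_prod)

lemma flag_gate_unitary:
  assumes "projector_mat n P" "state_vec n \<psi>"
  shows "unitary_mat (n * 4) (flag_gate P \<psi>)"
proof (cases "P = 0\<^sub>m n n")
  case True
  with assms show ?thesis by (auto simp: flag_gate_def state_vec_def unitary_mat_one)
next
  case False
  have n: "dim_row P = n" using assms by (auto simp: projector_mat_def)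
  note \<chi> = range_state[OF assms(1) False]
  have "dim_vec \<psi> = dim_vec (range_state P)" using assms(2) \<chi>(1) by (auto simp: state_vec_def)
  then show ?thesis
    using False n
    by (simp add: flag_gate_def swap_mat(1) tensor_vec_zero_two_orthogonal tensor_state_vec
        assms \<chi> unit_vec_state)
qed

text \<open>The bounds on \<open>a\<close> and \<open>b\<close> make the mixing vectors unit
  vectors, so the mixing gates are unitary for all \<open>P\<close> and \<open>\<psi>\<close> of
  every dimension.\<close>

lemma amplify_transform_B_transform:
  assumes "\<bar>a\<bar> \<le> 1" "\<bar>b\<bar> \<le> 1"
  shows "B_transform (amplify_transform a b m)"
  using assms
  by (auto simp: B_transform_def amplify_transform_def encode_steps_def flag_proj_projector
      mix_gate(3) reflect_gate_unitary flag_gate_unitary split: if_splits)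

section \<open>The transformed quantum system and its probability of outcome
  \<open>E\<close>\<close>

lemma step_mat_unitary:
  assumes Q: "quantum_system Q" and B: "B_transform B" and s: "s \<in> set (steps B)"
  shows "unitary_mat (dim_vec (input Q) * 2 ^ ancillas B) (step_mat (ancillas B) Q s)"
  using Q B s
  by (cases s) (auto simp: quantum_system_def Let_def B_transform_def
      intro!: unitary_mat_tensor unitary_mat_adjoint unitary_mat_one)

lemma apply_transform_quantum_system:
  assumes Q: "quantum_system Q" and B: "B_transform B"
  shows "quantum_system (apply_transform B Q)"
proof -
  have "state_vec (dim_vec (input Q) * 2 ^ ancillas B) (tensor_vec (input Q) (unit_vec (2 ^ ancillas B) 0))"
    using Q by (intro tensor_state_vec unit_vec_state) (auto simp: quantum_system_def Let_def)
  moreover have "projector_mat (dim_vec (input Q) * 2 ^ ancillas B) (tensor_mat (proj_E Q) (ancilla_proj B))"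
    using Q B by (intro projector_mat_tensor) (auto simp: quantum_system_def B_transform_def Let_def)
  moreover have "unitary_mat (dim_vec (input Q) * 2 ^ ancillas B) (steps_mat (ancillas B) Q (steps B))"
    by (intro steps_mat_unitary step_mat_unitary[OF Q B])
  ultimately show ?thesis
    by (simp add: quantum_system_def apply_transform_def Let_def)
qed

lemma prob_E_apply_transform:
  assumes Q: "quantum_system Q" and B: "B_transform B"
  shows "prob_E (apply_transform B Q) = sq_norm2 (tensor_mat (proj_E Q) (ancilla_proj B) *\<^sub>v
    fold (\<lambda>s. (*\<^sub>v) (step_mat (ancillas B) Q s)) (steps B)
      (tensor_vec (input Q) (unit_vec (2 ^ ancillas B) 0)))"
proof -
  have "tensor_vec (input Q) (unit_vec (2 ^ ancillas B) 0)
      \<in> carrier_vec (dim_vec (input Q) * 2 ^ ancillas B)"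
    by (intro carrier_vecI) simp
  then show ?thesis
    unfolding prob_E_def apply_transform_def
    using steps_mat_mult_vec[of "steps B" Q "ancillas B"] step_mat_unitary[OF Q B] by simp
qed

subsection \<open>Amplification\<close>

lemma smult_add_smult_minus:
  fixes u v :: "complex vec"
  assumes "u \<in> carrier_vec n" "v \<in> carrier_vec n" "a - c = a'"
  shows "a \<cdot>\<^sub>v u + b \<cdot>\<^sub>v v - c \<cdot>\<^sub>v u = a' \<cdot>\<^sub>v u + b \<cdot>\<^sub>v v"
  using assms by (intro eq_vecI) (auto simp: algebra_simps)

lemma zero_smult_add_smult:
  fixes u v :: "complex vec"
  assumes "u \<in> carrier_vec n" "v \<in> carrier_vec n"
  shows "0 \<cdot>\<^sub>v u + b \<cdot>\<^sub>v v = b \<cdot>\<^sub>v v"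
  using assms by (intro eq_vecI) auto

lemma smult_add_zero_smult:
  fixes u v :: "complex vec"
  assumes "u \<in> carrier_vec n" "v \<in> carrier_vec n"
  shows "a \<cdot>\<^sub>v u + 0 \<cdot>\<^sub>v v = a \<cdot>\<^sub>v u"
  using assms by (intro eq_vecI) auto

text \<open>One system is fixed here, while \<open>a\<close> and \<open>b\<close> will be shared by
  the whole collection. The name refers to \<open>f_e\<close>: the corner of \<open>V\<close> at the
  state \<open>e\<close> is the number \<open>p a + (1 - p) b\<close>.\<close>

locale block_encoding =
  fixes Q :: qsys and a b :: real
  assumes Q: "quantum_system Q" and a: "\<bar>a\<bar> \<le> 1" and b: "\<bar>b\<bar> \<le> 1"
begin

abbreviation "d \<equiv> dim_vec (input Q)"
abbreviation "P \<equiv> proj_E Q"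
abbreviation "\<phi> \<equiv> circuit Q *\<^sub>v input Q"
abbreviation "CI \<equiv> tensor_mat (circuit Q) (1\<^sub>m 4)"
abbreviation "G \<equiv> mix_gate a b P (input Q)"
abbreviation "za \<equiv> mix_mat a *\<^sub>v unit_vec 4 0"
abbreviation "zb \<equiv> mix_mat b *\<^sub>v unit_vec 4 0"

definition e :: "complex vec" where
  "e = tensor_vec (input Q) (unit_vec 4 0)"

definition V :: "complex vec \<Rightarrow> complex vec" where
  "V v = mat_adjoint CI *\<^sub>v (G *\<^sub>v (CI *\<^sub>v v))"

text \<open>Together with \<open>h\<close> below: the two branches of the measurement, pulled back
  through the circuit. They decompose the input state.\<close>

definition g :: "complex vec" where
  "g = mat_adjoint (circuit Q) *\<^sub>v (P *\<^sub>v \<phi>)"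

definition h :: "complex vec" where
  "h = mat_adjoint (circuit Q) *\<^sub>v ((1\<^sub>m d - P) *\<^sub>v \<phi>)"

definition f :: "complex vec" where
  "f = tensor_vec g za + tensor_vec h zb"

lemma input_state: "state_vec d (input Q)" and circuit_unitary: "unitary_mat d (circuit Q)"
  and P_projector: "projector_mat d P"
  using Q by (simp_all add: quantum_system_def Let_def)

lemma carriers [simp]:
  "input Q \<in> carrier_vec d" "circuit Q \<in> carrier_mat d d" "P \<in> carrier_mat d d"
  "1\<^sub>m d - P \<in> carrier_mat d d" "\<phi> \<in> carrier_vec d"
  "za \<in> carrier_vec 4" "zb \<in> carrier_vec 4" "mix_mat a \<in> carrier_mat 4 4" "mix_mat b \<in> carrier_mat 4 4"
  "CI \<in> carrier_mat (d * 4) (d * 4)" "G \<in> carrier_mat (d * 4) (d * 4)"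
proof -
  show "circuit Q \<in> carrier_mat d d" "P \<in> carrier_mat d d"
    using circuit_unitary P_projector by (auto simp: unitary_mat_def projector_mat_def)
  then show "1\<^sub>m d - P \<in> carrier_mat d d" "\<phi> \<in> carrier_vec d"
    "CI \<in> carrier_mat (d * 4) (d * 4)"
    by (auto intro: mult_mat_vec_carrier)
  show "za \<in> carrier_vec 4" "zb \<in> carrier_vec 4"
    using mix_mat_zero(1) a b by blast+
  show "mix_mat a \<in> carrier_mat 4 4" "mix_mat b \<in> carrier_mat 4 4"
    by (simp_all add: mix_vec_def)
  show "G \<in> carrier_mat (d * 4) (d * 4)"
    by (rule mix_gate(1)[OF P_projector input_state a b])
qed simp

lemma g_carrier [simp]: "g \<in> carrier_vec d" and h_carrier [simp]: "h \<in> carrier_vec d"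
  unfolding g_def h_def by (auto intro!: mult_mat_vec_carrier[of _ d d])

lemma e_carrier [simp]: "e \<in> carrier_vec (d * 4)"
  and f_carrier [simp]: "f \<in> carrier_vec (d * 4)"
  by (simp_all add: e_def f_def)

lemma e_state: "state_vec (d * 4) e"
  unfolding e_def by (intro tensor_state_vec input_state unit_vec_state) simp

lemma CI_unitary: "unitary_mat (d * 4) CI"
  by (intro unitary_mat_tensor circuit_unitary unitary_mat_one)

lemma V_lin:
  assumes "u \<in> carrier_vec (d * 4)" "v \<in> carrier_vec (d * 4)"
  shows "V (x \<cdot>\<^sub>v u + y \<cdot>\<^sub>v v) = x \<cdot>\<^sub>v V u + y \<cdot>\<^sub>v V v"
proof -
  have c: "CI *\<^sub>v w \<in> carrier_vec (d * 4)" "G *\<^sub>v w \<in> carrier_vec (d * 4)"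
    if "w \<in> carrier_vec (d * 4)" for w
    using that by (auto intro!: mult_mat_vec_carrier[of _ "d * 4" "d * 4"])
  show ?thesis
    using assms unfolding V_def
    by (simp add: smult_add_smult_mult_mat_vec[of _ "d * 4" "d * 4"] c)
qed

text \<open>\<open>V\<close> is the involution \<open>G\<close> conjugated by a unitary.
  Consequently it exchanges \<open>e\<close> and \<open>f\<close>, and their span is
  invariant.\<close>

lemma V_V:
  assumes v: "v \<in> carrier_vec (d * 4)"
  shows "V (V v) = v"
proof -
  have c: "CI *\<^sub>v v \<in> carrier_vec (d * 4)" "G *\<^sub>v (CI *\<^sub>v v) \<in> carrier_vec (d * 4)"
    using v by (auto intro!: mult_mat_vec_carrier[of _ "d * 4" "d * 4"])
  have "G *\<^sub>v (G *\<^sub>v (CI *\<^sub>v v)) = G * G *\<^sub>v (CI *\<^sub>v v)"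
    by (rule assoc_mult_mat_vec[symmetric, of _ "d * 4" "d * 4" _ "d * 4"]) (use c in auto)
  also have "\<dots> = CI *\<^sub>v v"
    using mix_gate(2)[OF P_projector input_state a b] c(1) by simp
  finally show ?thesis
    unfolding V_def using v c by (simp add: unitary_mat_cancel[OF CI_unitary])
qed

text \<open>Each summand of \<open>G\<close> is a tensor product, and the calls act on the first
  factor only, so \<open>V e\<close> remains a sum of two product vectors.\<close>

lemma V_e: "V e = f"
proof -
  have dims: "dim_vec \<phi> = d" "dim_col P = d" "dim_col (1\<^sub>m d - P) = d" "dim_col (circuit Q) = d"
    "dim_col (mix_mat a) = 4" "dim_col (mix_mat b) = 4" "dim_row (circuit Q) = d"
    "dim_row P = d" "dim_row (1\<^sub>m d - P) = d" "dim_vec za = 4" "dim_vec zb = 4"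
    "dim_row (mix_mat a) = 4" "dim_row (mix_mat b) = 4"
    using carriers by (auto simp del: carriers)
  have "CI *\<^sub>v e = tensor_vec \<phi> (unit_vec 4 0)"
    unfolding e_def by (subst tensor_mat_mult_vec) (simp_all add: dims)
  moreover have "G *\<^sub>v tensor_vec \<phi> (unit_vec 4 0) = tensor_mat P (mix_mat a) *\<^sub>v tensor_vec \<phi> (unit_vec 4 0)
      + tensor_mat (1\<^sub>m d - P) (mix_mat b) *\<^sub>v tensor_vec \<phi> (unit_vec 4 0)"
    unfolding mix_gate_def
    by (rule add_mult_distrib_mat_vec[of _ "d * 4" "d * 4"]) simp_all
  moreover have "\<dots> = tensor_vec (P *\<^sub>v \<phi>) za + tensor_vec ((1\<^sub>m d - P) *\<^sub>v \<phi>) zb"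
    by (simp only: tensor_mat_mult_vec dims index_unit_vec)
  moreover have "mat_adjoint CI *\<^sub>v \<dots> = mat_adjoint CI *\<^sub>v tensor_vec (P *\<^sub>v \<phi>) za
      + mat_adjoint CI *\<^sub>v tensor_vec ((1\<^sub>m d - P) *\<^sub>v \<phi>) zb"
    by (rule mult_add_distrib_mat_vec[of _ "d * 4" "d * 4"])
      (auto intro!: tensor_vec_carrier mult_mat_vec_carrier[of _ d d])
  moreover have "mat_adjoint CI *\<^sub>v tensor_vec (P *\<^sub>v \<phi>) za = tensor_vec g za"
    unfolding tensor_mat_adjoint g_def
    by (subst tensor_mat_mult_vec) (simp_all add: dims)
  moreover have "mat_adjoint CI *\<^sub>v tensor_vec ((1\<^sub>m d - P) *\<^sub>v \<phi>) zb = tensor_vec h zb"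
    unfolding tensor_mat_adjoint h_def
    by (subst tensor_mat_mult_vec) (simp_all add: dims)
  ultimately show ?thesis by (simp only: V_def f_def)
qed

section \<open>Overlaps of \<open>f\<close> with the initial state and with the flag level\<close>

lemma g_input: "g \<bullet>c input Q = complex_of_real (prob_E Q)"
proof -
  have P: "mat_adjoint P = P" "P * P = P" using P_projector by (auto simp: projector_mat_def)
  have c: "P *\<^sub>v \<phi> \<in> carrier_vec d" by (rule mult_mat_vec_carrier[of _ d d]) auto
  have "g \<bullet>c input Q = (P *\<^sub>v \<phi>) \<bullet>c \<phi>"
    unfolding g_def using c by (subst cscalar_prod_mult_mat_vec[of _ d d]) simp_all
  \<comment> \<open>Idempotence doubles \<open>P\<close>, and self-adjointness moves one copy to the
    right, which leaves a squared norm.\<close>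
  also have "P *\<^sub>v \<phi> = P *\<^sub>v (P *\<^sub>v \<phi>)"
    using assoc_mult_mat_vec[of P d d P d \<phi>] P by simp
  also have "\<dots> \<bullet>c \<phi> = (P *\<^sub>v \<phi>) \<bullet>c (P *\<^sub>v \<phi>)"
    using c by (subst cscalar_prod_mult_mat_vec[of _ d d]) (simp_all add: P)
  finally show ?thesis by (simp only: prob_E_def sq_norm2_cscalar_prod)
qed

lemma g_add_h: "g + h = input Q"
proof -
  have c: "P *\<^sub>v \<phi> \<in> carrier_vec d" "(1\<^sub>m d - P) *\<^sub>v \<phi> \<in> carrier_vec d"
    by (rule mult_mat_vec_carrier[of _ d d], auto)+
  have "g + h = mat_adjoint (circuit Q) *\<^sub>v (P *\<^sub>v \<phi> + (1\<^sub>m d - P) *\<^sub>v \<phi>)"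
    unfolding g_def h_def using c
    by (intro mult_add_distrib_mat_vec[symmetric, of _ d d]) simp_all
  also have "(1\<^sub>m d - P) *\<^sub>v \<phi> = \<phi> - P *\<^sub>v \<phi>"
    by (subst minus_mult_distrib_mat_vec[of _ d d]) (simp_all add: one_mult_mat_vec[of _ d])
  also have "P *\<^sub>v \<phi> + (\<phi> - P *\<^sub>v \<phi>) = \<phi>"
    using carrier_vecD[OF c(1)] carrier_vecD[OF carriers(5)] by (intro eq_vecI) auto
  finally show ?thesis by (simp add: unitary_mat_cancel[OF circuit_unitary])
qed

lemma h_input: "h \<bullet>c input Q = complex_of_real (1 - prob_E Q)"
proof -
  have "g \<bullet>c input Q + h \<bullet>c input Q = (g + h) \<bullet>c input Q"
    by (rule cscalar_prod_add_left[symmetric, of _ d]) simp_all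
  also have "\<dots> = input Q \<bullet>c input Q" by (simp only: g_add_h)
  also have "\<dots> = 1"
    using input_state by (simp add: state_vec_def flip: sq_norm2_cscalar_prod)
  finally have "h \<bullet>c input Q = 1 - g \<bullet>c input Q" by (metis add_diff_cancel_left')
  then show ?thesis by (simp only: g_input of_real_diff of_real_1)
qed

text \<open>Used with \<open>i = 0\<close> for the overlap with \<open>e\<close> and with
  \<open>i = 2\<close> for the flag level.\<close>

lemma f_tensor:
  assumes "u \<in> carrier_vec d" "i < 4"
  shows "f \<bullet>c tensor_vec u (unit_vec 4 i) = (g \<bullet>c u) * za $ i + (h \<bullet>c u) * zb $ i"
proof -
  have unit: "z \<bullet>c unit_vec 4 i = z $ i" if "z \<in> carrier_vec 4" for z :: "complex vec"
  proof -
    have "z \<bullet>c unit_vec 4 i = (\<Sum>j<4. if j = i then z $ j else 0)"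
      unfolding cscalar_prod_sum using assms by (intro sum.cong) auto
    then show ?thesis using assms by simp
  qed
  have dims: "dim_vec g = dim_vec u" "dim_vec h = dim_vec u" "dim_vec za = 4" "dim_vec zb = 4"
    using carrier_vecD[OF g_carrier] carrier_vecD[OF h_carrier] carrier_vecD[OF assms(1)]
      carrier_vecD[OF carriers(6)] carrier_vecD[OF carriers(7)] by simp_all
  have "f \<bullet>c tensor_vec u (unit_vec 4 i)
      = tensor_vec g za \<bullet>c tensor_vec u (unit_vec 4 i) + tensor_vec h zb \<bullet>c tensor_vec u (unit_vec 4 i)"
    unfolding f_def using assms by (intro cscalar_prod_add_left[of _ "d * 4"]) simp_all
  also have "\<dots> = (g \<bullet>c u) * (za \<bullet>c unit_vec 4 i) + (h \<bullet>c u) * (zb \<bullet>c unit_vec 4 i)"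
    by (simp only: tensor_vec_cscalar_prod dims index_unit_vec)
  finally show ?thesis by (simp only: unit carriers)
qed

lemma f_e: "f \<bullet>c e = complex_of_real (prob_E Q * a + (1 - prob_E Q) * b)"
  unfolding e_def
  by (subst f_tensor) (simp_all only: g_input h_input mix_mat_zero a b of_real_add of_real_mult carriers)

lemma f_flag:
  assumes "u \<in> carrier_vec d"
  shows "f \<bullet>c tensor_vec u (unit_vec 4 2) = 0"
  using assms a b by (simp add: f_tensor mix_mat_zero del: index_mult_mat_vec)

text \<open>Neither ancilla part of \<open>f\<close> has an amplitude at level \<open>2\<close>. A
  final state proportional to \<open>f\<close> therefore never yields outcome
  \<open>E\<close>.\<close>

lemma measure_f: "tensor_mat P flag_proj *\<^sub>v f = 0\<^sub>v (d * 4)"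
proof -
  have dims: "dim_vec g = d" "dim_vec h = d" "dim_vec za = 4" "dim_vec zb = 4"
    "dim_row P = d" "dim_col P = d" "dim_col flag_proj = 4"
    using carrier_vecD[OF g_carrier] carrier_vecD[OF h_carrier] carrier_vecD[OF carriers(6)]
      carrier_vecD[OF carriers(7)] carrier_matD[OF carriers(3)] carrier_matD[OF flag_proj_carrier]
    by simp_all
  have "0 \<cdot>\<^sub>v unit_vec 4 2 = (0\<^sub>v 4 :: complex vec)" by (intro eq_vecI) auto
  then have z: "flag_proj *\<^sub>v za = 0\<^sub>v 4" "flag_proj *\<^sub>v zb = 0\<^sub>v 4"
    using a b by (simp_all add: flag_proj_mult_vec mix_mat_zero del: index_mult_mat_vec)
  have "tensor_mat P flag_proj *\<^sub>v f
      = tensor_mat P flag_proj *\<^sub>v tensor_vec g za + tensor_mat P flag_proj *\<^sub>v tensor_vec h zb"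
    unfolding f_def by (rule mult_add_distrib_mat_vec[of _ "d * 4" "d * 4"]) simp_all
  also have "\<dots> = tensor_vec (P *\<^sub>v g) (0\<^sub>v 4) + tensor_vec (P *\<^sub>v h) (0\<^sub>v 4)"
    by (simp only: tensor_mat_mult_vec dims z)
  finally show ?thesis by (simp add: tensor_vec_zero_right dims)
qed

text \<open>For \<open>P \<noteq> 0\<close> the gate swaps \<open>e\<close> with a state at the flag
  level. By assumption \<open>f\<close> is orthogonal to the former, by \<open>f_flag\<close> to the
  latter.\<close>

lemma flag_gate_f:
  assumes "f \<bullet>c e = 0"
  shows "flag_gate P (input Q) *\<^sub>v f = f"
proof (cases "P = 0\<^sub>m d d")
  case True
  then have "flag_gate P (input Q) = 1\<^sub>m (d * 4)" by (simp add: flag_gate_def)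
  then show ?thesis by simp
next
  case False
  note \<chi> = range_state[OF P_projector False]
  have c: "range_state P \<in> carrier_vec d" using \<chi>(1) by (simp add: state_vec_def)
  have "flag_gate P (input Q) = swap_mat e (tensor_vec (range_state P) (unit_vec 4 2))"
    using False carrier_matD[OF carriers(3)] by (simp add: flag_gate_def e_def)
  then show ?thesis
    using swap_mat(3)[OF e_state, of "tensor_vec (range_state P) (unit_vec 4 2)" f] assms c
    by (simp add: f_flag tensor_state_vec \<chi> unit_vec_state
        tensor_vec_zero_two_orthogonal[of "input Q" "range_state P", folded e_def])
qed

text \<open>The gate carries \<open>e\<close> to a unit vector that both \<open>P\<close> and the
  flag projector fix, so the outcome is certain.\<close>

lemma measure_flag_gate_e:
  assumes "P \<noteq> 0\<^sub>m d d"
  shows "sq_norm2 (tensor_mat P flag_proj *\<^sub>v (flag_gate P (input Q) *\<^sub>v e)) = 1"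
proof -
  note \<chi> = range_state[OF P_projector assms]
  have c: "range_state P \<in> carrier_vec d" using \<chi>(1) by (simp add: state_vec_def)
  let ?t = "tensor_vec (range_state P) (unit_vec 4 2)"
  have t: "state_vec (d * 4) ?t" by (intro tensor_state_vec \<chi> unit_vec_state) simp
  have "flag_gate P (input Q) = swap_mat e ?t"
    using assms carrier_matD[OF carriers(3)] by (simp add: flag_gate_def e_def)
  then have "flag_gate P (input Q) *\<^sub>v e = ?t"
    using swap_mat(2)[OF e_state t] c
    by (simp add: tensor_vec_zero_two_orthogonal[of "input Q" "range_state P", folded e_def])
  moreover have "flag_proj *\<^sub>v unit_vec 4 2 = unit_vec 4 2"
    by (simp add: flag_proj_mult_vec)
  then have "tensor_mat P flag_proj *\<^sub>v ?t = ?t"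
    using carrier_matD[OF carriers(3)] carrier_matD[OF flag_proj_carrier] carrier_vecD[OF c]
    by (simp add: tensor_mat_mult_vec \<chi>)
  ultimately show ?thesis using t by (simp add: state_vec_def)
qed

text \<open>Reflecting along \<open>e\<close> changes the coefficient of \<open>e\<close> from
  \<open>p\<close> to \<open>2 cos \<theta> q - p\<close>, where \<open>q\<close> is that of
  \<open>f\<close>, and \<open>V\<close> then exchanges the coefficients: this is the map of
  \<open>plane_rotation_iterate\<close>. Writing the overlap as \<open>- cos \<theta>\<close>
  absorbs the sign of the reflection.\<close>

lemma amplify_transform_final:
  fixes \<theta> :: real and m :: nat
  assumes x: "prob_E Q * a + (1 - prob_E Q) * b = - cos \<theta>" and \<theta>: "sin \<theta> \<noteq> 0"
  shows "prob_E (apply_transform (amplify_transform a b m) Q) =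
    sq_norm2 (tensor_mat P flag_proj *\<^sub>v (flag_gate P (input Q) *\<^sub>v
      (complex_of_real (sin (m * \<theta>) / sin \<theta>) \<cdot>\<^sub>v e + complex_of_real (sin (Suc m * \<theta>) / sin \<theta>) \<cdot>\<^sub>v f)))"
proof -
  define T where "T v = V (reflect_gate P (input Q) *\<^sub>v v)" for v
  let ?F = "fold (\<lambda>s. (*\<^sub>v) (step_mat 2 Q s))"
  have enc: "?F (encode_steps a b) = V"
    by (simp add: fun_eq_iff encode_steps_def V_def tensor_mat_adjoint)
  have loop: "V \<circ> (*\<^sub>v) (reflect_gate P (input Q)) = T"
    by (simp add: fun_eq_iff T_def)
  have V_f: "V f = e" using V_V[of e] by (simp add: V_e)
  have ee: "e \<bullet>c e = 1" using e_state by (simp add: state_vec_def flip: sq_norm2_cscalar_prod)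
  have T_plane: "T (p \<cdot>\<^sub>v e + q \<cdot>\<^sub>v f) = q \<cdot>\<^sub>v e + (2 * complex_of_real (cos \<theta>) * q - p) \<cdot>\<^sub>v f" for p q
  proof -
    let ?v = "p \<cdot>\<^sub>v e + q \<cdot>\<^sub>v f"
    have fe: "f \<bullet>c e = - complex_of_real (cos \<theta>)" by (simp add: f_e x)
    have "?v \<bullet>c e = p - q * complex_of_real (cos \<theta>)"
      by (simp add: cscalar_prod_add_left[of _ "d * 4"] cscalar_prod_smult_left[of _ "d * 4"] ee fe)
    then have "reflect_gate P (input Q) *\<^sub>v ?v = ?v - (2 * (p - q * complex_of_real (cos \<theta>))) \<cdot>\<^sub>v e"
      unfolding reflect_gate_def e_def[symmetric]
      using householder_mult_vec[of e "d * 4" ?v] by simp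
    also have "\<dots> = (2 * complex_of_real (cos \<theta>) * q - p) \<cdot>\<^sub>v e + q \<cdot>\<^sub>v f"
      by (rule smult_add_smult_minus[OF e_carrier f_carrier]) simp
    finally have "T ?v = (2 * complex_of_real (cos \<theta>) * q - p) \<cdot>\<^sub>v f + q \<cdot>\<^sub>v e"
      unfolding T_def by (simp add: V_lin V_e V_f)
    also have "\<dots> = q \<cdot>\<^sub>v e + (2 * complex_of_real (cos \<theta>) * q - p) \<cdot>\<^sub>v f"
      by (rule comm_add_vec[of _ "d * 4"]) simp_all
    finally show ?thesis .
  qed
  \<comment> \<open>The first encoding block already maps \<open>e\<close> to \<open>f\<close>, so
    the iteration starts from \<open>f\<close>.\<close>
  have "?F (steps (amplify_transform a b m)) e = flag_gate P (input Q) *\<^sub>v ((T ^^ m) f)"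
    by (simp add: amplify_transform_def enc V_e fold_concat_replicate loop)
  moreover have "prob_E (apply_transform (amplify_transform a b m) Q)
      = sq_norm2 (tensor_mat P flag_proj *\<^sub>v ?F (steps (amplify_transform a b m)) e)"
    using prob_E_apply_transform[OF Q amplify_transform_B_transform[OF a b, of m]]
    by (simp add: amplify_transform_def e_def)
  ultimately show ?thesis
    using plane_rotation_iterate[OF e_carrier f_carrier \<theta> T_plane, of m] by simp
qed

section \<open>The two exact cases: outcome \<open>E\<close> impossible and outcome \<open>E\<close>
  certain\<close>

lemma flag_gate_carrier: "flag_gate P (input Q) \<in> carrier_mat (d * 4) (d * 4)"
  using flag_gate_unitary[OF P_projector input_state] by (simp add: unitary_mat_def)

text \<open>Overlap \<open>0\<close> means \<open>\<theta> = pi / 2\<close>. As the number of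
  iterations is even, the coefficient of \<open>e\<close> is \<open>sin (l * pi) = 0\<close> and a
  multiple of \<open>f\<close> remains.\<close>

lemma amplify_transform_zero:
  assumes "prob_E Q * a + (1 - prob_E Q) * b = 0"
  shows "prob_E (apply_transform (amplify_transform a b (2 * l)) Q) = 0"
proof -
  have 1: "sin (real (2 * l) * (pi / 2)) = 0" by (simp add: sin_npi mult.commute)
  define c where "c = complex_of_real (sin (real (Suc (2 * l)) * (pi / 2)) / sin (pi / 2))"
  have "0 \<cdot>\<^sub>v e + c \<cdot>\<^sub>v f = c \<cdot>\<^sub>v f"
    by (rule zero_smult_add_smult[OF e_carrier f_carrier])
  then have "prob_E (apply_transform (amplify_transform a b (2 * l)) Q)
      = sq_norm2 (tensor_mat P flag_proj *\<^sub>v (flag_gate P (input Q) *\<^sub>v (c \<cdot>\<^sub>v f)))"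
    using amplify_transform_final[of "pi / 2" "2 * l"] assms 1 by (simp add: c_def)
  also have "flag_gate P (input Q) *\<^sub>v (c \<cdot>\<^sub>v f) = c \<cdot>\<^sub>v f"
    using mult_mat_vec[OF flag_gate_carrier f_carrier] flag_gate_f f_e assms by simp
  also have "tensor_mat P flag_proj *\<^sub>v (c \<cdot>\<^sub>v f) = 0\<^sub>v (d * 4)"
    using mult_mat_vec[of "tensor_mat P flag_proj" "d * 4" "d * 4" f] measure_f
    by (auto intro!: eq_vecI)
  finally show ?thesis by (simp add: sq_norm2_def)
qed

text \<open>Here the coefficient of \<open>f\<close> vanishes and that of \<open>e\<close> is a
  sign. Positivity of the probability excludes \<open>P = 0\<close>, where the last gate would be
  the identity.\<close>

lemma amplify_transform_one:
  fixes l :: nat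
  assumes x: "prob_E Q * a + (1 - prob_E Q) * b = sin (pi / (2 * (2 * real l + 1)))" and "l > 0"
    and p: "prob_E Q > 0"
  shows "prob_E (apply_transform (amplify_transform a b (2 * l)) Q) = 1"
proof -
  \<comment> \<open>The shift by \<open>pi / 2\<close> turns the sine into
    \<open>- cos \<theta>\<close>. For \<open>l = 0\<close> the angle would be \<open>pi\<close>,
    with \<open>sin \<theta> = 0\<close>; this is where \<open>l > 0\<close> is needed.\<close>
  define \<theta> where "\<theta> = pi / 2 + pi / (2 * (2 * real l + 1))"
  have cos: "cos \<theta> = - sin (pi / (2 * (2 * real l + 1)))"
    by (simp add: \<theta>_def cos_add)
  have "sin \<theta> = cos (pi / (2 * (2 * real l + 1)))"
    by (simp add: \<theta>_def sin_add)
  moreover have "cos (pi / (2 * (2 * real l + 1))) > 0"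
  proof (rule cos_gt_zero_pi)
    have "0 < pi / (2 * (2 * real l + 1))" by simp
    then show "- (pi / 2) < pi / (2 * (2 * real l + 1))" using pi_gt_zero by linarith
    show "pi / (2 * (2 * real l + 1)) < pi / 2" using \<open>l > 0\<close> by (simp add: divide_simps)
  qed
  ultimately have sin: "sin \<theta> \<noteq> 0" by simp
  have "(2 * real l + 1) * \<theta> = (2 * real l + 1) * pi / 2 + (2 * real l + 1) * (pi / (2 * (2 * real l + 1)))"
    by (simp add: \<theta>_def algebra_simps)
  also have "(2 * real l + 1) * (pi / (2 * (2 * real l + 1))) = pi / 2"
    by (simp add: field_simps)
  \<comment> \<open>Since \<open>n \<theta>\<close> is a multiple of \<open>pi\<close>, the
    coefficient of \<open>f\<close> is zero, and that of \<open>e\<close> follows from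
    \<open>2 l \<theta> = n \<theta> - \<theta>\<close>.\<close>
  finally have n\<theta>: "(2 * real l + 1) * \<theta> = real (l + 1) * pi" by (simp add: field_simps)
  then have "sin (real (Suc (2 * l)) * \<theta>) = sin (real (l + 1) * pi)"
    by (simp add: add.commute)
  then have 0: "sin (real (Suc (2 * l)) * \<theta>) = 0" by (simp only: sin_npi)
  have "real (2 * l) * \<theta> = real (l + 1) * pi - \<theta>"
    using n\<theta> by (simp add: algebra_simps)
  then have 1: "sin (real (2 * l) * \<theta>) = - cos (real (l + 1) * pi) * sin \<theta>"
    by (simp only: sin_diff sin_npi)
  define c where "c = complex_of_real (sin (real (2 * l) * \<theta>) / sin \<theta>)"
  have c: "c = (- 1) ^ l"
    unfolding c_def 1 cos_npi using sin by simp
  have "c \<cdot>\<^sub>v e + 0 \<cdot>\<^sub>v f = c \<cdot>\<^sub>v e"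
    by (rule smult_add_zero_smult[OF e_carrier f_carrier])
  moreover have "prob_E Q * a + (1 - prob_E Q) * b = - cos \<theta>" using x cos by simp
  ultimately have "prob_E (apply_transform (amplify_transform a b (2 * l)) Q)
      = sq_norm2 (tensor_mat P flag_proj *\<^sub>v (flag_gate P (input Q) *\<^sub>v (c \<cdot>\<^sub>v e)))"
    using amplify_transform_final[OF _ sin, of "2 * l"]
    by (simp only: 0 c_def[symmetric] div_0 of_real_0)
  also have "\<dots> = sq_norm2 (c \<cdot>\<^sub>v (tensor_mat P flag_proj *\<^sub>v (flag_gate P (input Q) *\<^sub>v e)))"
    using mult_mat_vec[OF flag_gate_carrier e_carrier]
      mult_mat_vec[of "tensor_mat P flag_proj" "d * 4" "d * 4" "flag_gate P (input Q) *\<^sub>v e"]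
      mult_mat_vec_carrier[OF flag_gate_carrier e_carrier] by simp
  also have "\<dots> = sq_norm2 (tensor_mat P flag_proj *\<^sub>v (flag_gate P (input Q) *\<^sub>v e))"
    by (simp add: sq_norm2_def norm_mult c norm_power del: index_mult_mat_vec)
  also have "\<dots> = 1"
  proof (rule measure_flag_gate_e)
    show "P \<noteq> 0\<^sub>m d d"
    proof
      assume "P = 0\<^sub>m d d"
      then have "P *\<^sub>v \<phi> = 0\<^sub>v d" using carrier_vecD[OF carriers(5)] by (intro eq_vecI) simp_all
      then show False using p by (simp add: prob_E_def sq_norm2_def)
    qed
  qed
  finally show ?thesis .
qed

end

text \<open>The transform is chosen before the collection, so one transform serves all collections
  for the given \<open>\<delta>\<close> and \<open>\<epsilon>\<close>, including systems of
  different dimensions.\<close>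

theorem theorem4:
  fixes \<delta> \<epsilon> :: real
  assumes "0 \<le> \<delta>" and "\<delta> < \<epsilon>" and "\<epsilon> \<le> 1"
  shows "\<exists>B. B_transform B \<and>
    (\<forall>S. (\<forall>Q\<in>S. quantum_system Q \<and> (output_dist Q = mu \<delta> \<or> output_dist Q = mu \<epsilon>))
       \<longrightarrow> perfectly_solves B \<delta> \<epsilon> S)"
proof -
  \<comment> \<open>Large enough that \<open>sin (pi / (2 n))\<close> with
    \<open>n = 2 l + 1\<close> is at most \<open>\<epsilon> - \<delta>\<close>, by the estimate
    \<open>sin x \<le> x\<close>; this keeps the slope \<open>r\<close> below within
    \<open>[0, 1]\<close>.\<close>
  obtain l :: nat where l: "pi / (\<epsilon> - \<delta>) < real l" using reals_Archimedean2 by blast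
  have "0 < pi / (\<epsilon> - \<delta>)" using assms by simp
  with l have "l > 0" by (cases l) auto
  define s where "s = sin (pi / (2 * (2 * real l + 1)))"
  have "s \<le> pi / (2 * (2 * real l + 1))" unfolding s_def by (rule sin_x_le_x) simp
  also have "\<dots> \<le> pi / real l" using \<open>l > 0\<close> by (intro divide_left_mono) auto
  also have "\<dots> \<le> \<epsilon> - \<delta>" using l \<open>l > 0\<close> assms by (simp add: field_simps)
  finally have s: "s \<le> \<epsilon> - \<delta>" .
  have "pi / (2 * (2 * real l + 1)) \<le> pi" by (simp add: field_simps)
  then have s0: "0 \<le> s" unfolding s_def by (intro sin_ge_zero) auto
  define r where "r = s / (\<epsilon> - \<delta>)"
  have r: "0 \<le> r" "r \<le> 1" "r * (\<epsilon> - \<delta>) = s" using s s0 assms by (auto simp: r_def)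
  \<comment> \<open>Chosen so that \<open>p a + (1 - p) b = r (p - \<delta>)\<close>: the affine
    function of \<open>p\<close> that is \<open>0\<close> at \<open>\<delta>\<close> and
    \<open>s\<close> at \<open>\<epsilon>\<close>. Both values are bounded by \<open>1\<close> since
    \<open>r\<close>, \<open>\<delta>\<close> and \<open>1 - \<delta>\<close> lie in
    \<open>[0, 1]\<close>.\<close>
  define a b where "a = r * (1 - \<delta>)" and "b = - (r * \<delta>)"
  have ab: "\<bar>a\<bar> \<le> 1" "\<bar>b\<bar> \<le> 1"
    using r assms by (auto simp: a_def b_def abs_mult intro!: mult_le_one)
  let ?B = "amplify_transform a b (2 * l)"
  have B: "B_transform ?B" by (rule amplify_transform_B_transform[OF ab])
  have "perfectly_solves ?B \<delta> \<epsilon> S" if S: "\<forall>Q\<in>S. quantum_system Q" for S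
    unfolding perfectly_solves_def
  proof (intro ballI conjI impI)
    fix Q assume "Q \<in> S"
    then have Q: "quantum_system Q" using S by blast
    interpret block_encoding Q a b by unfold_locales (fact Q ab)+
    show "quantum_system (apply_transform ?B Q)"
      by (rule apply_transform_quantum_system[OF Q B])
    show "prob_E (apply_transform ?B Q) = 0" if "output_dist Q = mu \<delta>"
    proof (rule amplify_transform_zero)
      have "prob_E Q = \<delta>" using that by (simp add: output_dist_def mu_def)
      then show "prob_E Q * a + (1 - prob_E Q) * b = 0" by (simp add: a_def b_def algebra_simps)
    qed
    show "prob_E (apply_transform ?B Q) = 1" if "output_dist Q = mu \<epsilon>"
    proof (rule amplify_transform_one)
      have p: "prob_E Q = \<epsilon>" using that by (simp add: output_dist_def mu_def)
      then show "prob_E Q > 0" using assms by simp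
      have "prob_E Q * a + (1 - prob_E Q) * b = r * (\<epsilon> - \<delta>)"
        by (simp add: p a_def b_def algebra_simps)
      then show "prob_E Q * a + (1 - prob_E Q) * b = sin (pi / (2 * (2 * real l + 1)))"
        by (simp add: r s_def)
    qed fact
  qed
  with B show ?thesis by blast
qed

end
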